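(* Let $\mu$ be a Radon measure on $\mathbb{R}^n$, $1\le p<\infty$, $\gamma\in\mathbb{R}$, and $f\in L^1_{\rm loc}(\mathbb{R}^n,\mu)$. For $Q\in\mathcal{D}$ set $$a(f)_Q=\ell(Q)^{\gamma/p}\frac1{\mu(Q)}\int_Q f\,d\mu\ \text{ if }\mu(Q)>0,\qquad a(f)_Q=0\ \text{ otherwise},$$ and $b(f)_Q=\ell(Q)^{\gamma/p}O(f,Q)$. (i) Suppose that one of the following holds: $\gamma<0$; or $\gamma>d>0$ and $\mu(Q)\approx\ell(Q)^d$ for all $Q\in\mathcal{D}$; or $1<p<\infty$ and $\gamma\ne0$. Then $$\|a(f)\|_{l^{p,\infty}_\gamma(\mathbb{R}^n,\mu)}\lesssim\|f\|_{L^p(\mathbb{R}^n,\mu)}.$$ (ii) If $\mu$ is Lebesgue measure and $\gamma\in\mathbb{R}\setminus[0,n]$, then $$\|f\|_{\mathcal{O}^p_\gamma(\mathbb{R}^n)}:=\|b(f)\|_{l^{p,\infty}_\gamma(\mathbb{R}^n)}\lesssim\|f\|_{\mathrm{JN}_p(\mathbb{R}^n,\mathcal{D})}.$$ (iii) If $\mu$ is Lebesgue measure, $1<p<\infty$ and $f\in\dot W^{1,p}(\mathbb{R}^n)$, then $$\|f\|_{\mathcal{O}^p(\mathbb{R}^n)}\lesssim\|\nabla f\|_{L^p(\mathbb{R}^n)}.$$ The implied constants do not depend on $f$.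
   Context: $\mathcal{D}$ is the collection of half-open dyadic cubes $[j_12^k,(j_1+1)2^k)\times\cdots\times[j_n2^k,(j_n+1)2^k)$, $k\in\mathbb{Z}$, $j\in\mathbb{Z}^n$; $\ell(Q)$ is the sidelength. $A\lesssim B$ means $A\le cB$ for a constant $c$ (here depending only on $n,p,\gamma$ and, where relevant, on $d$ and the constants in $\mu(Q)\approx\ell(Q)^d$); $A\approx B$ means $A\lesssim B$ and $B\lesssim A$. The mean oscillation is $O(f,Q)=\frac1{\mu(Q)}\int_Q|f-f_Q|\,d\mu$ with $f_Q=\frac1{\mu(Q)}\int_Qf\,d\mu$; in (ii) and (iii) it is taken with respect to Lebesgue measure. For a sequence $a=\{a_Q\}_{Q\in\mathcal{D}}$, $$\|a\|_{l^{p,\infty}_\gamma(\mathbb{R}^n,\mu)}=\Big(\sup_{\lambda>0}\lambda^p\sum_{Q\in\mathcal{D},\,|a_Q|>\lambda}\ell(Q)^{-\gamma}\mu(Q)\Big)^{1/p},$$ and $\mu$ is omitted from the notation when it is Lebesgue measure. Furthermore $$\|f\|_{\mathrm{JN}_p(\mathbb{R}^n,\mathcal{D})}=\Big(\sup_{\mathcal{P}}\sum_{Q\in\mathcal{P}}|Q|\,O(f,Q)^p\Big)^{1/p},$$ the supremum over all collections $\mathcal{P}\subset\mathcal{D}$ of pairwise disjoint cubes, and $$\|f\|_{\mathcal{O}^p(\mathbb{R}^n)}=\Big(\sup_{\lambda>0}\lambda^p\sum_{Q\in\mathcal{D},\,O(f,Q)>\lambda}\ell(Q)^{-p}|Q|\Big)^{1/p}.$$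 $\dot W^{1,p}(\mathbb{R}^n)$ is the homogeneous Sobolev space of locally integrable functions whose weak gradient is in $L^p(\mathbb{R}^n)$. *)

theory Defs
  imports "HOL-Analysis.Analysis"
begin

text \<open>Norms take values in \<^typ>\<open>ennreal\<close>, so that they may be infinite. The power \<open>x\<^sup>r\<close>
  below is only meant for \<open>r > 0\<close>.\<close>

definition ennpowr :: "ennreal \<Rightarrow> real \<Rightarrow> ennreal" where
  "ennpowr x r = (if x = \<infinity> then \<infinity> else ennreal (enn2real x powr r))"


section \<open>Measures and function spaces\<close>

text \<open>The sigma-algebra may be larger than the Borel one, so that \<^term>\<open>lebesgue\<close> is covered as
  well as Borel measures.\<close>

definition radon_measure :: "'a::topological_space measure \<Rightarrow> bool" where
  "radon_measure \<mu> \<longleftrightarrow>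
     space \<mu> = UNIV \<and> sets borel \<subseteq> sets \<mu> \<and>
     (\<forall>K. compact K \<longrightarrow> emeasure \<mu> K < \<infinity>) \<and>
     (\<forall>A\<in>sets \<mu>. emeasure \<mu> A = (INF U\<in>{U. open U \<and> A \<subseteq> U}. emeasure \<mu> U)) \<and>
     (\<forall>U. open U \<longrightarrow> emeasure \<mu> U = (SUP K\<in>{K. compact K \<and> K \<subseteq> U}. emeasure \<mu> K))"

definition locally_integrable :: "'a::topological_space measure \<Rightarrow> ('a \<Rightarrow> real) \<Rightarrow> bool" where
  "locally_integrable \<mu> f \<longleftrightarrow> (\<forall>K. compact K \<longrightarrow> set_integrable \<mu> K f)"

definition Lp_norm :: "real \<Rightarrow> 'a measure \<Rightarrow> ('a \<Rightarrow> 'b::real_normed_vector) \<Rightarrow> ennreal" where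
  "Lp_norm p \<mu> f = ennpowr (\<integral>\<^sup>+x. ennreal (norm (f x) powr p) \<partial>\<mu>) (1 / p)"


section \<open>Dyadic cubes\<close>

definition dyadic_cube :: "int \<Rightarrow> int ^ 'n \<Rightarrow> (real ^ 'n) set" where
  "dyadic_cube k j =
     {x. \<forall>i. of_int (j $ i) * 2 powi k \<le> x $ i \<and> x $ i < (of_int (j $ i) + 1) * 2 powi k}"

definition dyadic_cubes :: "(real ^ 'n) set set" where
  "dyadic_cubes = {dyadic_cube k j | k j. True}"

definition sidelength :: "(real ^ 'n) set \<Rightarrow> real" where
  "sidelength Q = 2 powi (THE k. \<exists>j. Q = dyadic_cube k j)"

lemma dyadic_cube_scale_unique:
  fixes j j' :: "int ^ 'n"
  assumes "dyadic_cube k j = dyadic_cube k' j'"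
  shows "k = k'"
proof -
  have le: "k \<le> k'" if eq: "dyadic_cube k j = dyadic_cube k' j'" for k k' and j j' :: "int ^ 'n"
  proof (rule ccontr)
    assume "\<not> k \<le> k'"
    then have lt: "(2::real) powi k' < 2 powi k"
      by (intro power_int_strict_increasing) auto
    define x :: "real ^ 'n" where "x = (\<chi> i. of_int (j $ i) * 2 powi k)"
    define y :: "real ^ 'n" where "y = (\<chi> i. of_int (j $ i) * 2 powi k + 2 powi k')"
    have "x \<in> dyadic_cube k j" "y \<in> dyadic_cube k j"
      using lt by (auto simp: dyadic_cube_def x_def y_def algebra_simps)
    then have "x \<in> dyadic_cube k' j'" "y \<in> dyadic_cube k' j'"
      using eq by auto
    then have "of_int (j' $ i) * 2 powi k' \<le> x $ i" "y $ i < (of_int (j' $ i) + 1) * 2 powi k'" for i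
      by (auto simp: dyadic_cube_def)
    from this[of undefined] show False
      by (simp add: x_def y_def algebra_simps)
  qed
  show ?thesis
    using le[OF assms] le[OF assms[symmetric]] by simp
qed

lemma sidelength_dyadic_cube [simp]: "sidelength (dyadic_cube k j) = 2 powi k"
proof -
  have "(THE k'. \<exists>j'. dyadic_cube k j = dyadic_cube k' j') = k"
    by (rule the_equality) (auto dest: dyadic_cube_scale_unique)
  then show ?thesis
    by (simp add: sidelength_def)
qed


section \<open>Averages, oscillations and the associated norms\<close>

definition average :: "'a measure \<Rightarrow> ('a \<Rightarrow> real) \<Rightarrow> 'a set \<Rightarrow> real" where
  "average \<mu> f Q = (1 / measure \<mu> Q) * (LINT x:Q|\<mu>. f x)"

definition mean_osc :: "'a measure \<Rightarrow> ('a \<Rightarrow> real) \<Rightarrow> 'a set \<Rightarrow> real" where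
  "mean_osc \<mu> f Q = (1 / measure \<mu> Q) * (LINT x:Q|\<mu>. \<bar>f x - average \<mu> f Q\<bar>)"

text \<open>The sequence norm \<open>l\<^sup>p\<^sup>,\<^sup>\<infinity>\<^sub>\<gamma>\<close>; a sequence is a function of the cube, of which only the values
  on \<^const>\<open>dyadic_cubes\<close> matter. The sum over the selected cubes is written as an integral for
  the counting measure.\<close>

definition weak_lp_norm ::
  "real \<Rightarrow> real \<Rightarrow> (real ^ 'n) measure \<Rightarrow> ((real ^ 'n) set \<Rightarrow> real) \<Rightarrow> ennreal" where
  "weak_lp_norm p \<gamma> \<mu> a =
     ennpowr (SUP t\<in>{0<..}. ennreal (t powr p) *
       (\<integral>\<^sup>+Q. ennreal (sidelength Q powr (- \<gamma>)) * emeasure \<mu> Q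
          \<partial>count_space {Q \<in> dyadic_cubes. \<bar>a Q\<bar> > t})) (1 / p)"

definition avg_seq ::
  "real \<Rightarrow> real \<Rightarrow> (real ^ 'n) measure \<Rightarrow> (real ^ 'n \<Rightarrow> real) \<Rightarrow> (real ^ 'n) set \<Rightarrow> real" where
  "avg_seq p \<gamma> \<mu> f Q =
     (if emeasure \<mu> Q > 0 then sidelength Q powr (\<gamma> / p) * average \<mu> f Q else 0)"

definition osc_seq ::
  "real \<Rightarrow> real \<Rightarrow> (real ^ 'n) measure \<Rightarrow> (real ^ 'n \<Rightarrow> real) \<Rightarrow> (real ^ 'n) set \<Rightarrow> real" where
  "osc_seq p \<gamma> \<mu> f Q = sidelength Q powr (\<gamma> / p) * mean_osc \<mu> f Q"

definition Op_gamma_norm :: "real \<Rightarrow> real \<Rightarrow> (real ^ 'n \<Rightarrow> real) \<Rightarrow> ennreal" where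
  "Op_gamma_norm p \<gamma> f = weak_lp_norm p \<gamma> lebesgue (osc_seq p \<gamma> lebesgue f)"

definition JN_norm :: "real \<Rightarrow> (real ^ 'n \<Rightarrow> real) \<Rightarrow> ennreal" where
  "JN_norm p f =
     ennpowr (SUP P\<in>{P. P \<subseteq> dyadic_cubes \<and> pairwise disjnt P}.
       (\<integral>\<^sup>+Q. emeasure lebesgue Q * ennreal (mean_osc lebesgue f Q powr p) \<partial>count_space P)) (1 / p)"

text \<open>In contrast to \<^const>\<open>Op_gamma_norm\<close> with \<open>\<gamma> = p\<close>, the level sets here are those of the
  oscillation itself, without a power of the side length.\<close>

definition Op_norm :: "real \<Rightarrow> (real ^ 'n \<Rightarrow> real) \<Rightarrow> ennreal" where
  "Op_norm p f =
     ennpowr (SUP t\<in>{0<..}. ennreal (t powr p) *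
       (\<integral>\<^sup>+Q. ennreal (sidelength Q powr (- p)) * emeasure lebesgue Q
          \<partial>count_space {Q \<in> dyadic_cubes. mean_osc lebesgue f Q > t})) (1 / p)"


section \<open>The homogeneous Sobolev space\<close>

definition partial_deriv :: "'n \<Rightarrow> (real ^ 'n \<Rightarrow> real) \<Rightarrow> real ^ 'n \<Rightarrow> real" where
  "partial_deriv i \<phi> x = frechet_derivative \<phi> (at x) (axis i 1)"

primrec Ck :: "nat \<Rightarrow> (real ^ 'n \<Rightarrow> real) \<Rightarrow> bool" where
  "Ck 0 \<phi> \<longleftrightarrow> continuous_on UNIV \<phi>"
| "Ck (Suc k) \<phi> \<longleftrightarrow> (\<forall>x. \<phi> differentiable (at x)) \<and> (\<forall>i. Ck k (partial_deriv i \<phi>))"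

definition test_function :: "(real ^ 'n \<Rightarrow> real) \<Rightarrow> bool" where
  "test_function \<phi> \<longleftrightarrow> (\<forall>k. Ck k \<phi>) \<and> compact (closure {x. \<phi> x \<noteq> 0})"

definition weak_gradient :: "(real ^ 'n \<Rightarrow> real) \<Rightarrow> (real ^ 'n \<Rightarrow> real ^ 'n) \<Rightarrow> bool" where
  "weak_gradient f g \<longleftrightarrow>
     locally_integrable lebesgue f \<and> (\<forall>i. locally_integrable lebesgue (\<lambda>x. g x $ i)) \<and>
     (\<forall>\<phi> i. test_function \<phi> \<longrightarrow>
        (LINT x|lebesgue. f x * partial_deriv i \<phi> x) = - (LINT x|lebesgue. g x $ i * \<phi> x))"

definition homogeneous_sobolev :: "real \<Rightarrow> (real ^ 'n \<Rightarrow> real) set" where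
  "homogeneous_sobolev p = {f. \<exists>g. weak_gradient f g \<and> Lp_norm p lebesgue g < \<infinity>}"

end

theory Submission
  imports Defs
begin

text \<open>All estimates rest on geometric sums. For \<open>p = 1\<close> in (i) and for (ii), each selected cube
  satisfies \<open>\<lambda>\<^sup>p \<ell>(Q)\<^sup>-\<^sup>\<gamma> \<mu>(Q) \<le> \<Phi>(Q)\<close> with \<open>\<Phi>\<close> summable over disjoint families, and a finite selection is
  dominated by its maximal cubes (\<open>\<gamma> < 0\<close>) or by its minimal cubes (\<open>\<gamma> > d\<close>). For \<open>p > 1\<close> every
  generation is treated separately: its selected cubes are disjoint, and the resulting truncated
  integrals add up because the thresholds are in geometric progression; no maximal function is needed.

  Part (iii) is (i) with \<open>\<gamma> = p\<close> applied to \<open>\<Sum>\<^sub>i \<bar>\<partial>\<^sub>i f\<bar>\<close>, by the Poincare inequality on cubes. For the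
  latter, testing the weak derivative against products of one-dimensional bumps shows that
  \<open>f (x + h e\<^sub>i) - f x\<close> is almost everywhere the integral of \<open>\<partial>\<^sub>i f\<close> along the segment. Regarding the
  cube as a torus, \<open>\<integral>\<integral> \<bar>f x - f z\<bar>\<close> becomes an average over translations, each of which is a
  composition of one-dimensional ones.\<close>

text \<open>The conditions on \<gamma> say which end of a chain of cubes wins. Inside a cube M, the
  cubes of generation k weigh at most 2^(-\<gamma> k) \<mu>(M) in total, and these bounds decay
  towards small cubes only if \<gamma> < 0. Around M, a chain has weights comparable to 2^((d -
  \<gamma>) k), which decay towards large cubes only if \<gamma> > d. For p > 1, all but one power
  of the threshold is split off, and what has to be summed over generations has ratio 2^(-\<gamma>
  (p - 1) / p). This ratio is 1 when p = 1, so that case needs the packing arguments.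

  The obstacle in the Poincare inequality is that translating a point may take it out of the cube.
  On the torus of side l, a shift by s along an axis either moves a point forward by s or back by l
  - s, both along segments inside the cube. The two costs s and l - s add up to l, which is where
  the side length in the inequality comes from. Translations and Fubini are applied to Borel
  representatives, since functions in the Sobolev space are only Lebesgue measurable.\<close>

section \<open>Powers of extended reals and reduction of countable sums to finite ones\<close>

lemma ennpowr_mono:
  assumes "x \<le> y" "0 \<le> r"
  shows "ennpowr x r \<le> ennpowr y r"
proof (cases "y = \<infinity>")
  case False
  then have "x \<noteq> \<infinity>" "enn2real x \<le> enn2real y"
    using assms by (auto simp: top_unique enn2real_mono top.not_eq_extremum)
  then show ?thesis
    using False assms by (auto simp: ennpowr_def intro!: ennreal_leI powr_mono2)
qed (simp add: ennpowr_def)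

lemma ennpowr_mult_ennreal:
  assumes "0 < c"
  shows "ennpowr (ennreal c * x) r = ennreal (c powr r) * ennpowr x r"
  using assms
  by (cases x) (auto simp: ennpowr_def ennreal_mult_top powr_mult ennreal_mult'[symmetric] ennreal_mult_eq_top_iff)

lemma ennpowr_le_mult:
  assumes "x \<le> ennreal c * y" "0 < c" "0 \<le> r"
  shows "ennpowr x r \<le> ennreal (c powr r) * ennpowr y r"
  using ennpowr_mono[OF assms(1,3)] ennpowr_mult_ennreal[OF assms(2)] by simp

text \<open>This reduces all estimates to finite families of cubes. There every cube lies in a
  maximal one and contains a minimal one, whereas an infinite family may contain endless
  chains.\<close>

lemma nn_integral_count_space_le:
  fixes w :: "'a \<Rightarrow> ennreal"
  assumes A: "countable A" and le: "\<And>F. finite F \<Longrightarrow> F \<subseteq> A \<Longrightarrow> sum w F \<le> B"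
  shows "(\<integral>\<^sup>+x. w x \<partial>count_space A) \<le> B"
proof (cases "finite A")
  case True
  then show ?thesis using le[of A] by (simp add: nn_integral_count_space_finite)
next
  case False
  have bij: "bij_betw (from_nat_into A) UNIV A"
    using A False by (rule bij_betw_from_nat_into)
  then have "(\<integral>\<^sup>+x. w x \<partial>count_space A) = (\<Sum>n. w (from_nat_into A n))"
    by (simp add: nn_integral_bij_count_space[symmetric] nn_integral_count_space_nat)
  also have "\<dots> \<le> B"
  proof (rule suminf_le_const)
    fix n
    have inj: "inj_on (from_nat_into A) {..<n}"
      using bij by (meson bij_betw_imp_inj_on inj_on_subset subset_UNIV)
    have "sum w (from_nat_into A ` {..<n}) \<le> B"
      using bij by (intro le) (auto dest: bij_betw_imp_surj_on)
    then show "(\<Sum>i<n. w (from_nat_into A i)) \<le> B"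
      by (simp add: sum.reindex[OF inj])
  qed simp
  finally show ?thesis .
qed

section \<open>Finite sums of geometric progressions\<close>

lemma sum_powi_le_gt1:
  fixes x :: real
  assumes x: "x > 1" and K: "finite K" and m: "\<And>k. k \<in> K \<Longrightarrow> k \<le> m"
  shows "(\<Sum>k\<in>K. x powi k) \<le> x powi m / (1 - 1 / x)"
proof -
  have inj: "inj_on (\<lambda>k. nat (m - k)) K"
    using m by (intro inj_onI) (metis diff_ge_0_iff_ge eq_nat_nat_iff diff_left_imp_eq)
  have "(\<Sum>k\<in>K. x powi k) = (\<Sum>k\<in>K. x powi m * (1 / x) ^ nat (m - k))"
  proof (rule sum.cong)
    fix k assume "k \<in> K"
    then have "x powi k = x powi (m - int (nat (m - k)))" using m by simp
    also have "\<dots> = x powi m * (1 / x) ^ nat (m - k)"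
      using x by (simp add: power_int_diff power_inverse divide_inverse del: int_nat_eq)
    finally show "x powi k = x powi m * (1 / x) ^ nat (m - k)" .
  qed simp
  also have "\<dots> = x powi m * (\<Sum>j\<in>(\<lambda>k. nat (m - k)) ` K. (1 / x) ^ j)"
    by (simp add: sum_distrib_left sum.reindex[OF inj])
  also have "\<dots> \<le> x powi m * (\<Sum>j. (1 / x) ^ j)"
    using x K by (intro mult_left_mono sum_le_suminf) (auto intro!: summable_geometric)
  also have "\<dots> = x powi m / (1 - 1 / x)"
    using x by (simp add: suminf_geometric)
  finally show ?thesis .
qed

text \<open>The sum of the geometric series whose ratio is the smaller of x and 1/x. Being symmetric
  under inversion, it serves increasing and decreasing progressions alike.\<close>

definition geom_const :: "real \<Rightarrow> real" where
  "geom_const x = 1 / (1 - min x (1 / x))"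

lemma geom_const_pos: "x > 0 \<Longrightarrow> x \<noteq> 1 \<Longrightarrow> geom_const x > 0"
  unfolding geom_const_def by (cases "x < 1") (simp_all add: min_less_iff_disj)

text \<open>The largest term dominates a geometric sum, so a bound \<open>Y\<close> on the terms
  suffices, whichever end of \<open>K\<close> is the large one. A ratio below 1 is inverted by
  negating the exponents.\<close>

lemma sum_powi_le:
  fixes x :: real
  assumes x: "x > 0" "x \<noteq> 1" and K: "finite K" and le: "\<And>k. k \<in> K \<Longrightarrow> x powi k \<le> Y" and "0 \<le> Y"
  shows "(\<Sum>k\<in>K. x powi k) \<le> geom_const x * Y"
proof (cases "K = {}")
  case True
  then show ?thesis using geom_const_pos[OF x] \<open>0 \<le> Y\<close> by simp
next
  case False
  have main: "(\<Sum>k\<in>K. x powi k) \<le> geom_const x * Y"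
    if x: "x > 1" and K: "finite K" "K \<noteq> {}" and le: "\<And>k. k \<in> K \<Longrightarrow> x powi k \<le> Y" for x and K :: "int set"
  proof -
    have mn: "min x (1 / x) = 1 / x"
      using x less_1_mult[OF x x] by (simp add: min_def divide_simps)
    have "(\<Sum>k\<in>K. x powi k) \<le> x powi (Max K) / (1 - 1 / x)"
      using K by (intro sum_powi_le_gt1 x) auto
    also have "\<dots> \<le> Y / (1 - 1 / x)"
      using x K le[of "Max K"] by (intro divide_right_mono) auto
    finally show ?thesis by (simp add: geom_const_def mn)
  qed
  show ?thesis
  proof (cases "x > 1")
    case True
    then show ?thesis using main K False le by blast
  next
    case lt: False
    have eq: "(1 / x) powi (- k) = x powi k" for k
      using x by (simp add: power_int_minus power_int_divide_distrib divide_simps)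
    have "(\<Sum>k\<in>uminus ` K. (1 / x) powi k) \<le> geom_const (1 / x) * Y"
      using x lt K False le eq by (intro main) auto
    then show ?thesis
      using eq by (simp add: sum.reindex geom_const_def min.commute)
  qed
qed

lemma powi_powr: "(2 powi k) powr a = (2 powr a :: real) powi k"
proof -
  have "(2::real) powi k = 2 powr (real_of_int k)"
    by (simp add: powr_real_of_int')
  moreover have "(2 powr a :: real) powi k = (2 powr a) powr (real_of_int k)"
    by (simp add: powr_real_of_int')
  ultimately show ?thesis by (simp add: powr_powr mult.commute)
qed

section \<open>Dyadic cubes\<close>

text \<open>The integer exponent behind \<open>sidelength\<close>, kept separate because the
  geometric sums are indexed by it. Larger cubes have larger generation.\<close>

definition generation :: "(real ^ 'n) set \<Rightarrow> int" where
  "generation Q = (THE k. \<exists>j. Q = dyadic_cube k j)"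

lemma generation_dyadic_cube [simp]: "generation (dyadic_cube k j) = k"
  unfolding generation_def by (rule the_equality) (auto dest: dyadic_cube_scale_unique)

lemma sidelength_eq: "sidelength Q = 2 powi generation Q"
  by (simp add: sidelength_def generation_def)

lemma sidelength_powr: "sidelength Q powr a = (2 powr a) powi generation Q"
  by (simp add: sidelength_eq powi_powr)

lemma dyadic_cubesE:
  assumes "Q \<in> dyadic_cubes"
  obtains j where "Q = dyadic_cube (generation Q) j"
  using assms by (auto simp: dyadic_cubes_def)

text \<open>Identifying the index of a cube with the floors of the rescaled coordinates of any of
  its points turns inclusions between cubes into integer arithmetic.\<close>

lemma dyadic_cube_mem: "x \<in> dyadic_cube k j \<longleftrightarrow> (\<forall>i. j $ i = \<lfloor>x $ i / 2 powi k\<rfloor>)"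
  unfolding dyadic_cube_def mem_Collect_eq
  by (intro all_cong1) (auto simp: field_simps floor_eq_iff eq_commute[of "j $ _"])

lemma dyadic_cube_corner: "(\<chi> i. of_int (j $ i) * 2 powi k) \<in> dyadic_cube k j"
  by (simp add: dyadic_cube_def)

lemma dyadic_cubes_nonempty: "Q \<in> dyadic_cubes \<Longrightarrow> Q \<noteq> {}"
  using dyadic_cube_corner by (force simp: dyadic_cubes_def)

text \<open>The reason for nestedness: the index of a point at a fine scale determines its index at
  every coarser scale, by integer division.\<close>

lemma floor_divide_powi:
  fixes y :: real
  assumes "k \<le> k'"
  shows "\<lfloor>y / 2 powi k'\<rfloor> = \<lfloor>y / 2 powi k\<rfloor> div 2 ^ nat (k' - k)"
proof -
  have "(2::real) powi k' = 2 powi (k + int (nat (k' - k)))" using assms by simp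
  also have "\<dots> = 2 powi k * 2 ^ nat (k' - k)"
    by (simp add: power_int_add del: int_nat_eq)
  finally have "y / 2 powi k' = (y / 2 powi k) / real_of_int (2 ^ nat (k' - k))" by simp
  then show ?thesis
    by (simp only: floor_divide_real_eq_div[of "2 ^ nat (k' - k)" "y / 2 powi k"] zero_le_power zero_le_numeral)
qed

lemma dyadic_cubes_nested:
  assumes Q: "Q \<in> dyadic_cubes" and R: "R \<in> dyadic_cubes" and le: "generation Q \<le> generation R"
    and ne: "Q \<inter> R \<noteq> {}"
  shows "Q \<subseteq> R"
proof -
  obtain j j' where Qj: "Q = dyadic_cube (generation Q) j" and Rj: "R = dyadic_cube (generation R) j'"
    using Q R by (metis dyadic_cubesE)
  obtain z where "z \<in> Q" "z \<in> R" using ne by auto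
  then have z: "j $ i = \<lfloor>z $ i / 2 powi generation Q\<rfloor>" "j' $ i = \<lfloor>z $ i / 2 powi generation R\<rfloor>" for i
    using Qj Rj dyadic_cube_mem by metis+
  show ?thesis
  proof
    fix x assume "x \<in> Q"
    then have "j $ i = \<lfloor>x $ i / 2 powi generation Q\<rfloor>" for i
      using Qj dyadic_cube_mem by metis
    then have "j' $ i = \<lfloor>x $ i / 2 powi generation R\<rfloor>" for i
      by (metis z floor_divide_powi[OF le])
    then show "x \<in> R" using Rj dyadic_cube_mem by metis
  qed
qed

lemma dyadic_cubes_disjnt:
  assumes "Q \<in> dyadic_cubes" "R \<in> dyadic_cubes" "generation Q = generation R" "Q \<noteq> R"
  shows "disjnt Q R"
  using assms dyadic_cubes_nested[of Q R] dyadic_cubes_nested[of R Q]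
  by (auto simp: disjnt_def)

lemma generation_mono:
  assumes "Q \<in> dyadic_cubes" "R \<in> dyadic_cubes" "Q \<subseteq> R"
  shows "generation Q \<le> generation R"
  by (metis assms dyadic_cubes_nested dyadic_cubes_nonempty inf.absorb_iff2 inf.commute nle_le subset_antisym)

lemma dyadic_cube_le_box:
  "box (\<chi> i. of_int (j $ i) * 2 powi k) (\<chi> i. (of_int (j $ i) + 1) * 2 powi k) \<subseteq> dyadic_cube k j"
  "dyadic_cube k j \<subseteq> cbox (\<chi> i. of_int (j $ i) * 2 powi k) (\<chi> i. (of_int (j $ i) + 1) * 2 powi k)"
  by (auto simp: dyadic_cube_def mem_box_cart less_imp_le)

lemma dyadic_cube_borel [measurable]: "dyadic_cube k j \<in> sets borel"
  unfolding dyadic_cube_def by measurable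

lemma dyadic_cubes_borel: "Q \<in> dyadic_cubes \<Longrightarrow> Q \<in> sets borel"
  by (auto simp: dyadic_cubes_def)

lemma countable_dyadic_cubes: "countable (dyadic_cubes :: (real ^ 'n) set set)"
proof -
  have "inj (\<lambda>j :: int ^ 'n. vec_nth j)"
    by (simp add: inj_on_def vec_eq_iff fun_eq_iff)
  moreover have "countable (UNIV :: ('n \<Rightarrow> int) set)"
    by simp
  ultimately have "countable (UNIV :: (int ^ 'n) set)"
    by (meson countable_image_inj_on countable_subset subset_UNIV)
  then have "countable (\<Union>k. range (dyadic_cube k) :: (real ^ 'n) set set)" by simp
  moreover have "dyadic_cubes = (\<Union>k. range (dyadic_cube k) :: (real ^ 'n) set set)"
    by (auto simp: dyadic_cubes_def)
  ultimately show ?thesis by simp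
qed

lemma emeasure_dyadic_cube:
  "emeasure lborel (dyadic_cube k j :: (real ^ 'n) set) = ennreal ((2 powi k) ^ CARD('n))"
proof -
  let ?a = "\<chi> i. of_int (j $ i) * 2 powi k :: real ^ 'n"
  let ?b = "\<chi> i. (of_int (j $ i) + 1) * 2 powi k :: real ^ 'n"
  have le: "?a \<bullet> b \<le> ?b \<bullet> b" if "b \<in> Basis" for b
    using that by (auto simp: Basis_vec_def inner_axis algebra_simps)
  have "(\<Prod>b\<in>Basis. (?b - ?a) \<bullet> b) = (\<Prod>b\<in>(Basis :: (real ^ 'n) set). 2 powi k)"
    by (intro prod.cong) (auto simp: Basis_vec_def inner_axis algebra_simps)
  also have "\<dots> = (2 powi k) ^ DIM(real ^ 'n)"
    by (rule prod_constant)
  finally have pr: "(\<Prod>b\<in>Basis. (?b - ?a) \<bullet> b) = (2 powi k) ^ CARD('n)"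
    by simp
  have "emeasure lborel (box ?a ?b) \<le> emeasure lborel (dyadic_cube k j)"
    by (intro emeasure_mono dyadic_cube_le_box) auto
  moreover have "emeasure lborel (dyadic_cube k j) \<le> emeasure lborel (cbox ?a ?b)"
    by (intro emeasure_mono dyadic_cube_le_box) auto
  moreover have "emeasure lborel (box ?a ?b) = ennreal ((2 powi k) ^ CARD('n))"
    using le pr by (simp add: emeasure_lborel_box)
  moreover have "emeasure lborel (cbox ?a ?b) = ennreal ((2 powi k) ^ CARD('n))"
    using le pr by (simp add: emeasure_lborel_cbox)
  ultimately show ?thesis by (intro antisym) (auto simp: ennreal_power)
qed

lemma emeasure_lebesgue_dyadic:
  fixes Q :: "(real ^ 'n) set"
  assumes "Q \<in> dyadic_cubes"
  shows "emeasure lebesgue Q = ennreal (sidelength Q powr real CARD('n))"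
proof -
  obtain j where j: "Q = dyadic_cube (generation Q) j" using assms by (rule dyadic_cubesE)
  have "emeasure lebesgue Q = emeasure lborel Q"
    using dyadic_cubes_borel[OF assms] by simp
  also have "\<dots> = ennreal (sidelength Q ^ CARD('n))"
    by (subst j, subst emeasure_dyadic_cube) (simp add: sidelength_eq)
  finally show ?thesis by (simp add: powr_realpow sidelength_eq)
qed

section \<open>Packing\<close>

text \<open>Each cube of \<open>F\<close> is charged to the members of \<open>P\<close> related to
  it. Being charged several times only enlarges the bound. The relation is inclusion in a maximal
  cube, or containment of a minimal one.\<close>

lemma sum_le_sum_related:
  fixes w :: "'a \<Rightarrow> ennreal"
  assumes "finite F" "finite P"
    and cover: "\<And>Q. Q \<in> F \<Longrightarrow> \<exists>M\<in>P. r Q M"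
    and le: "\<And>M. M \<in> P \<Longrightarrow> sum w {Q\<in>F. r Q M} \<le> c * w M"
  shows "sum w F \<le> c * sum w P"
proof -
  have "sum w F \<le> (\<Sum>Q\<in>F. \<Sum>M\<in>P. if r Q M then w Q else 0)"
  proof (rule sum_mono)
    fix Q assume "Q \<in> F"
    then obtain M where M: "M \<in> P" "r Q M" using cover by blast
    then have "w Q = (\<Sum>M\<in>{M}. if r Q M then w Q else 0)" by simp
    also have "\<dots> \<le> (\<Sum>M\<in>P. if r Q M then w Q else 0)"
      using M assms by (intro sum_mono2) auto
    finally show "w Q \<le> (\<Sum>M\<in>P. if r Q M then w Q else 0)" .
  qed
  also have "\<dots> = (\<Sum>M\<in>P. sum w {Q\<in>F. r Q M})"
    using assms(1) by (subst sum.swap) (simp add: sum.inter_filter)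
  also have "\<dots> \<le> (\<Sum>M\<in>P. c * w M)" by (rule sum_mono) (rule le)
  finally show ?thesis by (simp add: sum_distrib_left)
qed

lemma sum_emeasure_disjnt_le:
  assumes "finite A" "pairwise disjnt A" "A \<subseteq> sets M" "\<And>Q. Q \<in> A \<Longrightarrow> Q \<subseteq> X" "X \<in> sets M"
  shows "(\<Sum>Q\<in>A. emeasure M Q) \<le> emeasure M X"
proof -
  have "(\<Sum>Q\<in>A. emeasure M Q) = emeasure M (\<Union>Q\<in>A. Q)"
    using assms by (intro sum_emeasure) (auto simp: disjoint_family_on_def pairwise_def disjnt_def)
  also have "\<dots> \<le> emeasure M X"
    using assms by (intro emeasure_mono) auto
  finally show ?thesis .
qed

lemma pairwise_disjnt_generation:
  assumes "A \<subseteq> dyadic_cubes" "\<And>Q. Q \<in> A \<Longrightarrow> generation Q = k"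
  shows "pairwise disjnt A"
  unfolding pairwise_def using assms dyadic_cubes_disjnt by (metis subsetD)

text \<open>Two dyadic cubes that meet are comparable, so the maximal or the minimal cubes of a
  family are disjoint.\<close>

lemma pairwise_disjnt_antichain:
  assumes "A \<subseteq> dyadic_cubes" "\<And>M N. M \<in> A \<Longrightarrow> N \<in> A \<Longrightarrow> M \<subseteq> N \<Longrightarrow> M = N"
  shows "pairwise disjnt A"
proof (rule pairwiseI, rule ccontr)
  fix M N assume *: "M \<in> A" "N \<in> A" "M \<noteq> N" "\<not> disjnt M N"
  then have ne: "M \<inter> N \<noteq> {}" "N \<inter> M \<noteq> {}" by (auto simp: disjnt_def)
  have "M \<subseteq> N \<or> N \<subseteq> M"
    using dyadic_cubes_nested[OF _ _ _ ne(1)] dyadic_cubes_nested[OF _ _ _ ne(2)] assms(1) *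
    by (meson linear subsetD)
  then show False using * assms(2) by blast
qed

text \<open>The cubes of one generation inside a maximal cube M are disjoint, so their measures sum
  to at most \<mu>(M). What remains is a geometric sum over generations, with its largest term at
  the generation of M. The constant is therefore independent of \<mu>.\<close>

lemma packing_negative:
  fixes \<mu> :: "(real ^ 'n) measure"
  assumes \<mu>: "sets borel \<subseteq> sets \<mu>" and \<gamma>: "\<gamma> < 0" and F: "finite F" "F \<subseteq> dyadic_cubes"
    and w: "\<And>Q. Q \<in> dyadic_cubes \<Longrightarrow> w Q = s * (ennreal (sidelength Q powr (- \<gamma>)) * emeasure \<mu> Q)"
    and B: "\<And>P. P \<subseteq> F \<Longrightarrow> pairwise disjnt P \<Longrightarrow> sum w P \<le> B"
  shows "sum w F \<le> ennreal (geom_const (2 powr (- \<gamma>))) * B"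
proof -
  define x :: real where "x = 2 powr (- \<gamma>)"
  have x: "x > 1" using \<gamma> by (simp add: x_def)
  have w': "w Q = s * (ennreal (x powi generation Q) * emeasure \<mu> Q)" if "Q \<in> dyadic_cubes" for Q
    using w[OF that] by (simp add: sidelength_powr x_def)
  define P where "P = {M\<in>F. \<forall>Q\<in>F. M \<subseteq> Q \<longrightarrow> Q = M}"
  have P: "P \<subseteq> F" "finite P" using F by (simp_all add: P_def)
  have "sum w F \<le> ennreal (geom_const x) * sum w P"
  proof (rule sum_le_sum_related[where r = "(\<subseteq>)"])
    fix Q assume "Q \<in> F"
    from finite_has_maximal2[OF F(1) this]
    obtain M where M: "M \<in> F" "Q \<subseteq> M" "\<forall>R\<in>F. M \<subseteq> R \<longrightarrow> M = R"
      by (elim bexE conjE)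
    then have "M \<in> P"
      unfolding P_def mem_Collect_eq by metis
    then show "\<exists>M\<in>P. Q \<subseteq> M"
      using M(2) by (rule rev_bexI)
  next
    fix M assume "M \<in> P"
    then have M: "M \<in> dyadic_cubes" using P F by auto
    let ?A = "{Q\<in>F. Q \<subseteq> M}"
    have fin: "finite ?A" using F by auto
    have "sum w ?A = (\<Sum>k\<in>generation ` ?A. \<Sum>Q | Q \<in> ?A \<and> generation Q = k. w Q)"
      by (rule sum.image_gen[OF fin])
    also have "\<dots> \<le> (\<Sum>k\<in>generation ` ?A. s * (ennreal (x powi k) * emeasure \<mu> M))"
    proof (rule sum_mono)
      fix k assume "k \<in> generation ` ?A"
      let ?B = "{Q. Q \<in> ?A \<and> generation Q = k}"
      have "(\<Sum>Q\<in>?B. w Q) = s * (ennreal (x powi k) * (\<Sum>Q\<in>?B. emeasure \<mu> Q))"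
        using F w' by (auto simp: sum_distrib_left intro!: sum.cong)
      also have "(\<Sum>Q\<in>?B. emeasure \<mu> Q) \<le> emeasure \<mu> M"
        using F \<mu> M dyadic_cubes_borel
        by (intro sum_emeasure_disjnt_le pairwise_disjnt_generation) auto
      finally show "(\<Sum>Q\<in>?B. w Q) \<le> s * (ennreal (x powi k) * emeasure \<mu> M)"
        by (simp add: mult_left_mono)
    qed
    also have "\<dots> = s * (ennreal (\<Sum>k\<in>generation ` ?A. x powi k) * emeasure \<mu> M)"
      using x by (simp add: sum_distrib_right[symmetric] sum_distrib_left[symmetric] sum_ennreal)
    \<comment> \<open>Subcubes of M have generation at most that of M and x > 1, so
      \<open>x powi generation M\<close> bounds every term.\<close>
    also have "\<dots> \<le> s * (ennreal (geom_const x * x powi generation M) * emeasure \<mu> M)"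
      using x F M fin
      by (intro mult_left_mono mult_right_mono ennreal_leI sum_powi_le)
        (auto intro!: power_int_increasing generation_mono)
    also have "\<dots> = ennreal (geom_const x) * w M"
      using w'[OF M] x geom_const_pos[of x] by (simp add: ennreal_mult' mult_ac)
    finally show "sum w ?A \<le> ennreal (geom_const x) * w M" .
  qed (use F P in auto)
  also have "sum w P \<le> B"
    using P F unfolding P_def by (intro B pairwise_disjnt_antichain) blast+
  finally show ?thesis by (simp add: x_def mult_left_mono)
qed

text \<open>The cubes above a minimal cube M form a chain with one cube per generation at most, and
  by \<open>c1\<close> their weights are bounded by powers of 2^(d - \<gamma>) < 1. So M itself
  carries the largest bound, and \<open>c2\<close> converts this bound back into the weight of
  M.\<close>

lemma packing_doubling:
  fixes \<mu> :: "(real ^ 'n) measure"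
  assumes \<gamma>: "d < \<gamma>" and F: "finite F" "F \<subseteq> dyadic_cubes"
    and c1: "\<And>Q. Q \<in> F \<Longrightarrow> emeasure \<mu> Q \<le> ennreal c1 * ennreal (sidelength Q powr d)"
    and c2: "\<And>Q. Q \<in> F \<Longrightarrow> ennreal (sidelength Q powr d) \<le> ennreal c2 * emeasure \<mu> Q"
    and w: "\<And>Q. Q \<in> dyadic_cubes \<Longrightarrow> w Q = s * (ennreal (sidelength Q powr (- \<gamma>)) * emeasure \<mu> Q)"
    and B: "\<And>P. P \<subseteq> F \<Longrightarrow> pairwise disjnt P \<Longrightarrow> sum w P \<le> B"
  shows "sum w F \<le> ennreal c1 * ennreal c2 * ennreal (geom_const (2 powr (d - \<gamma>))) * B"
proof -
  define x :: real where "x = 2 powr (d - \<gamma>)"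
  have x: "0 < x" "x < 1" using \<gamma> powr_less_mono[of "d - \<gamma>" 0 2] by (auto simp: x_def)
  have xQ: "sidelength Q powr (- \<gamma>) * sidelength Q powr d = x powi generation Q" for Q :: "(real ^ 'n) set"
    by (simp add: x_def sidelength_powr[symmetric] powr_add[symmetric])
  define P where "P = {M\<in>F. \<forall>Q\<in>F. Q \<subseteq> M \<longrightarrow> Q = M}"
  have P: "P \<subseteq> F" "finite P" using F by (simp_all add: P_def)
  let ?c = "ennreal c1 * ennreal c2 * ennreal (geom_const x)"
  have "sum w F \<le> ?c * sum w P"
  proof (rule sum_le_sum_related[where r = "\<lambda>Q M. M \<subseteq> Q"])
    fix Q assume "Q \<in> F"
    from finite_has_minimal2[OF F(1) this]
    obtain M where M: "M \<in> F" "M \<subseteq> Q" "\<forall>R\<in>F. R \<subseteq> M \<longrightarrow> M = R"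
      by (elim bexE conjE)
    then have "M \<in> P"
      unfolding P_def mem_Collect_eq by metis
    then show "\<exists>M\<in>P. M \<subseteq> Q"
      using M(2) by (rule rev_bexI)
  next
    fix M assume "M \<in> P"
    then have M: "M \<in> dyadic_cubes" "M \<in> F" using P F by auto
    let ?A = "{Q\<in>F. M \<subseteq> Q}"
    have fin: "finite ?A" using F by auto
    \<comment> \<open>Two cubes of the same generation that both contain M meet, hence
      coincide.\<close>
    have inj: "inj_on generation ?A"
    proof (rule inj_onI)
      fix Q R assume *: "Q \<in> ?A" "R \<in> ?A" "generation Q = generation R"
      then have "\<not> disjnt Q R"
        using dyadic_cubes_nonempty[OF M(1)] by (auto simp: disjnt_def)
      then show "Q = R" using * F dyadic_cubes_disjnt by blast
    qed
    have "sum w ?A \<le> (\<Sum>Q\<in>?A. s * (ennreal c1 * ennreal (x powi generation Q)))"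
    proof (rule sum_mono)
      fix Q assume Q: "Q \<in> ?A"
      then have "w Q = s * (ennreal (sidelength Q powr (- \<gamma>)) * emeasure \<mu> Q)"
        using w F by auto
      also have "\<dots> \<le> s * (ennreal (sidelength Q powr (- \<gamma>)) * (ennreal c1 * ennreal (sidelength Q powr d)))"
        using Q c1 by (intro mult_left_mono) auto
      finally show "w Q \<le> s * (ennreal c1 * ennreal (x powi generation Q))"
        by (simp add: xQ[symmetric] ennreal_mult' mult_ac)
    qed
    also have "\<dots> = s * (ennreal c1 * ennreal (\<Sum>k\<in>generation ` ?A. x powi k))"
      using x by (simp add: sum.reindex[OF inj] sum_distrib_left[symmetric] sum_ennreal)
    \<comment> \<open>Now x < 1 and the generations are at least that of M, so the power at M is
      again the largest.\<close>
    also have "\<dots> \<le> s * (ennreal c1 * ennreal (geom_const x * x powi generation M))"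
      using x F M fin
      by (intro mult_left_mono ennreal_leI sum_powi_le)
        (auto intro!: power_int_decreasing generation_mono)
    also have "\<dots> = s * (ennreal c1 * ennreal (geom_const x) *
        (ennreal (sidelength M powr (- \<gamma>)) * ennreal (sidelength M powr d)))"
      using geom_const_pos[of x] x by (simp add: xQ[symmetric] ennreal_mult' mult_ac)
    also have "\<dots> \<le> s * (ennreal c1 * ennreal (geom_const x) *
        (ennreal (sidelength M powr (- \<gamma>)) * (ennreal c2 * emeasure \<mu> M)))"
      by (intro mult_left_mono c2 M) auto
    also have "\<dots> = ?c * w M"
      using w[OF M(1)] by (simp add: mult_ac)
    finally show "sum w ?A \<le> ?c * w M" .
  qed (use F P in auto)
  also have "sum w P \<le> B"
    using P F unfolding P_def by (intro B pairwise_disjnt_antichain) blast+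
  finally show ?thesis by (simp add: x_def mult_left_mono)
qed

section \<open>Weak type estimates\<close>

lemma SUP_level_sum_le:
  fixes a :: "(real ^ 'n) set \<Rightarrow> real"
  assumes le: "\<And>t F. t > 0 \<Longrightarrow> finite F \<Longrightarrow> F \<subseteq> {Q\<in>dyadic_cubes. \<bar>a Q\<bar> > t} \<Longrightarrow>
      (\<Sum>Q\<in>F. ennreal (t powr p) * (ennreal (sidelength Q powr (- \<gamma>)) * emeasure \<mu> Q)) \<le> B"
  shows "(SUP t\<in>{0<..}. ennreal (t powr p) *
       (\<integral>\<^sup>+Q. ennreal (sidelength Q powr (- \<gamma>)) * emeasure \<mu> Q
          \<partial>count_space {Q \<in> dyadic_cubes. \<bar>a Q\<bar> > t})) \<le> B"
proof (rule SUP_least)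
  fix t :: real assume t: "t \<in> {0<..}"
  have "ennreal (t powr p) * (\<integral>\<^sup>+Q. ennreal (sidelength Q powr (- \<gamma>)) * emeasure \<mu> Q
      \<partial>count_space {Q \<in> dyadic_cubes. \<bar>a Q\<bar> > t}) =
    (\<integral>\<^sup>+Q. ennreal (t powr p) * (ennreal (sidelength Q powr (- \<gamma>)) * emeasure \<mu> Q)
      \<partial>count_space {Q \<in> dyadic_cubes. \<bar>a Q\<bar> > t})"
    by (rule nn_integral_cmult[symmetric]) simp
  also have "\<dots> \<le> B"
    using t by (intro nn_integral_count_space_le le)
      (auto intro: countable_subset[OF _ countable_dyadic_cubes])
  finally show "ennreal (t powr p) * (\<integral>\<^sup>+Q. ennreal (sidelength Q powr (- \<gamma>)) * emeasure \<mu> Q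
      \<partial>count_space {Q \<in> dyadic_cubes. \<bar>a Q\<bar> > t}) \<le> B" .
qed

text \<open>The form in which all weak type bounds are proved: p-th powers, one level, finitely many
  selected cubes. Taking the p-th root turns C into \<open>C powr (1 / p)\<close>.\<close>

lemma weak_lp_norm_le:
  fixes a :: "(real ^ 'n) set \<Rightarrow> real"
  assumes le: "\<And>t F. t > 0 \<Longrightarrow> finite F \<Longrightarrow> F \<subseteq> {Q\<in>dyadic_cubes. \<bar>a Q\<bar> > t} \<Longrightarrow>
      (\<Sum>Q\<in>F. ennreal (t powr p) * (ennreal (sidelength Q powr (- \<gamma>)) * emeasure \<mu> Q)) \<le> ennreal C * B"
    and "0 < C" "0 < p"
  shows "weak_lp_norm p \<gamma> \<mu> a \<le> ennreal (C powr (1 / p)) * ennpowr B (1 / p)"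
  unfolding weak_lp_norm_def
  by (rule ennpowr_le_mult[OF SUP_level_sum_le[OF le]]) (use assms in auto)

section \<open>Sequences of averages for measures finite on compact sets\<close>

text \<open>What Radon measures and \<open>lebesgue\<close> have in common for these estimates.
  Finiteness on compact sets gives cubes finite measure, which permits cancelling multiples of
  \<mu>(Q) in inequalities between extended reals.\<close>

locale cube_measure =
  fixes \<mu> :: "(real ^ 'n) measure"
  assumes space_UNIV: "space \<mu> = UNIV"
    and borel_sets: "sets borel \<subseteq> sets \<mu>"
    and compact_finite: "\<And>K. compact K \<Longrightarrow> emeasure \<mu> K < \<infinity>"
begin

lemma cube_sets: "Q \<in> dyadic_cubes \<Longrightarrow> Q \<in> sets \<mu>"
  using dyadic_cubes_borel borel_sets by blast

lemma cube_finite: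
  assumes "Q \<in> dyadic_cubes"
  shows "emeasure \<mu> Q < \<infinity>"
proof -
  obtain j where j: "Q = dyadic_cube (generation Q) j" using assms by (rule dyadic_cubesE)
  let ?K = "cbox (\<chi> i. of_int (j $ i) * 2 powi generation Q) (\<chi> i. (of_int (j $ i) + 1) * 2 powi generation Q)"
  have "Q \<subseteq> ?K" using j dyadic_cube_le_box(2) by metis
  then have "emeasure \<mu> Q \<le> emeasure \<mu> ?K"
    using borel_sets by (intro emeasure_mono) auto
  then show ?thesis using compact_finite[of ?K] by (auto intro: le_less_trans)
qed

lemma locally_integrable_cube:
  assumes f: "locally_integrable \<mu> f" and Q: "Q \<in> dyadic_cubes"
  shows "set_integrable \<mu> Q f"
proof -
  obtain j where j: "Q = dyadic_cube (generation Q) j" using Q by (rule dyadic_cubesE)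
  let ?K = "cbox (\<chi> i. of_int (j $ i) * 2 powi generation Q) (\<chi> i. (of_int (j $ i) + 1) * 2 powi generation Q)"
  have "Q \<subseteq> ?K" using j dyadic_cube_le_box(2) by metis
  moreover have "set_integrable \<mu> ?K f" using f by (simp add: locally_integrable_def)
  ultimately show ?thesis using cube_sets[OF Q] by (auto intro: set_integrable_subset)
qed

text \<open>Local integrability only speaks of restrictions to compact sets; f is the pointwise
  limit of its truncations to growing balls.\<close>

lemma locally_integrable_measurable:
  assumes f: "locally_integrable \<mu> f"
  shows "f \<in> borel_measurable \<mu>"
proof (rule borel_measurable_LIMSEQ_real)
  fix n :: nat
  have "set_integrable \<mu> (cball 0 (real n)) f"
    using f by (simp add: locally_integrable_def)
  then show "(\<lambda>x. indicat_real (cball 0 (real n)) x *\<^sub>R f x) \<in> borel_measurable \<mu>"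
    unfolding set_integrable_def by (rule borel_measurable_integrable)
next
  fix x :: "real ^ 'n"
  obtain N :: nat where N: "norm x \<le> N" using real_arch_simple by blast
  have "indicat_real (cball 0 (real n)) x *\<^sub>R f x = f x" if "n \<ge> N" for n
    using that N by (auto simp: indicator_def)
  then show "(\<lambda>n. indicat_real (cball 0 (real n)) x *\<^sub>R f x) \<longlonglongrightarrow> f x"
    by (intro tendsto_eventually) (auto simp: eventually_sequentially)
qed

text \<open>The level t of the sequence is the threshold t \<ell>(Q)^(-\<gamma>/p) for averages over
  Q. Multiplied by \<mu>(Q), this compares directly with the integral of |f|.\<close>

lemma avg_seq_level:
  assumes f: "locally_integrable \<mu> f" and Q: "Q \<in> dyadic_cubes" and t: "t > 0" "\<bar>avg_seq p \<gamma> \<mu> f Q\<bar> > t"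
  shows "ennreal (t * sidelength Q powr (- \<gamma> / p)) * emeasure \<mu> Q \<le> (\<integral>\<^sup>+x\<in>Q. ennreal \<bar>f x\<bar> \<partial>\<mu>)"
proof -
  define m where "m = measure \<mu> Q"
  have em: "emeasure \<mu> Q = ennreal m"
    using cube_finite[OF Q] by (simp add: m_def emeasure_eq_ennreal_measure)
  \<comment> \<open>On null cubes \<open>avg_seq\<close> is 0 by definition, which a positive level
    excludes.\<close>
  have pos: "emeasure \<mu> Q > 0"
    using t by (auto simp: avg_seq_def split: if_splits)
  then have m: "m > 0" using em by (simp add: m_def ennreal_zero_less_mult_iff)
  have s: "sidelength Q > 0" by (simp add: sidelength_eq)
  have int: "integrable \<mu> (\<lambda>x. indicat_real Q x *\<^sub>R f x)"
    using locally_integrable_cube[OF f Q] by (simp add: set_integrable_def)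
  have "t < sidelength Q powr (\<gamma> / p) * (\<bar>LINT x:Q|\<mu>. f x\<bar> / m)"
    using t pos m by (simp add: avg_seq_def average_def abs_mult m_def)
  then have "t * sidelength Q powr (- \<gamma> / p) * m \<le> \<bar>LINT x:Q|\<mu>. f x\<bar>"
    using m s by (simp add: powr_minus field_simps)
  also have "\<dots> \<le> (\<integral>x. \<bar>indicat_real Q x *\<^sub>R f x\<bar> \<partial>\<mu>)"
    unfolding set_lebesgue_integral_def by (rule integral_abs_bound)
  finally have "ennreal (t * sidelength Q powr (- \<gamma> / p) * m) \<le> ennreal (\<integral>x. \<bar>indicat_real Q x *\<^sub>R f x\<bar> \<partial>\<mu>)"
    by (rule ennreal_leI)
  also have "\<dots> = (\<integral>\<^sup>+x. ennreal \<bar>indicat_real Q x *\<^sub>R f x\<bar> \<partial>\<mu>)"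
    using int by (intro nn_integral_eq_integral[symmetric]) (auto simp del: real_scaleR_def)
  also have "\<dots> = (\<integral>\<^sup>+x\<in>Q. ennreal \<bar>f x\<bar> \<partial>\<mu>)"
    by (intro nn_integral_cong) (auto simp: indicator_def)
  finally show ?thesis
    using t em m by (simp add: ennreal_mult')
qed

lemma sum_set_nn_integral_disjnt_le:
  assumes h: "h \<in> borel_measurable \<mu>" and A: "finite A" "A \<subseteq> dyadic_cubes" "pairwise disjnt A"
  shows "(\<Sum>Q\<in>A. \<integral>\<^sup>+x\<in>Q. h x \<partial>\<mu>) \<le> (\<integral>\<^sup>+x. h x \<partial>\<mu>)"
proof -
  \<comment> \<open>Viewed as measures of cubes under the density h, the integrals fall under the
    additivity lemma for disjoint sets.\<close>
  have "(\<Sum>Q\<in>A. \<integral>\<^sup>+x\<in>Q. h x \<partial>\<mu>) = (\<Sum>Q\<in>A. emeasure (density \<mu> h) Q)"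
    using A h cube_sets by (intro sum.cong) (auto simp: emeasure_density)
  also have "\<dots> \<le> emeasure (density \<mu> h) (space \<mu>)"
    using A h cube_sets sets.top[of \<mu>] by (intro sum_emeasure_disjnt_le) (auto simp: space_UNIV)
  also have "\<dots> = (\<integral>\<^sup>+x. h x \<partial>\<mu>)"
    using h by (simp add: emeasure_density cong: nn_integral_cong)
  finally show ?thesis .
qed

lemma Lp_norm_1: "Lp_norm 1 \<mu> f = (\<integral>\<^sup>+x. ennreal (norm (f x)) \<partial>\<mu>)"
  by (cases "\<integral>\<^sup>+x. ennreal (norm (f x)) \<partial>\<mu>") (auto simp: Lp_norm_def ennpowr_def)

text \<open>For p = 1 the threshold exponent -\<gamma>/p coincides with the exponent of the weight,
  so the term of a selected cube is at most the integral of |f| over it. This is the summable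
  majorant that packing needs.\<close>

lemma avg_seq_disjnt_le:
  assumes f: "locally_integrable \<mu> f" and t: "t > 0"
    and P: "finite P" "P \<subseteq> {Q\<in>dyadic_cubes. \<bar>avg_seq 1 \<gamma> \<mu> f Q\<bar> > t}" "pairwise disjnt P"
  shows "(\<Sum>Q\<in>P. ennreal t * (ennreal (sidelength Q powr (- \<gamma>)) * emeasure \<mu> Q)) \<le> Lp_norm 1 \<mu> f"
proof -
  have "(\<Sum>Q\<in>P. ennreal t * (ennreal (sidelength Q powr (- \<gamma>)) * emeasure \<mu> Q)) \<le>
      (\<Sum>Q\<in>P. \<integral>\<^sup>+x\<in>Q. ennreal \<bar>f x\<bar> \<partial>\<mu>)"
  proof (rule sum_mono)
    fix Q assume "Q \<in> P"
    then show "ennreal t * (ennreal (sidelength Q powr (- \<gamma>)) * emeasure \<mu> Q) \<le> (\<integral>\<^sup>+x\<in>Q. ennreal \<bar>f x\<bar> \<partial>\<mu>)"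
      using avg_seq_level[OF f, of Q t 1 \<gamma>] P t by (auto simp: ennreal_mult' mult.assoc)
  qed
  also have "\<dots> \<le> (\<integral>\<^sup>+x. ennreal \<bar>f x\<bar> \<partial>\<mu>)"
    using P locally_integrable_measurable[OF f] by (intro sum_set_nn_integral_disjnt_le) auto
  finally show ?thesis by (simp add: Lp_norm_1)
qed

lemma weak_type_negative:
  assumes f: "locally_integrable \<mu> f" and \<gamma>: "\<gamma> < 0"
  shows "weak_lp_norm 1 \<gamma> \<mu> (avg_seq 1 \<gamma> \<mu> f) \<le> ennreal (geom_const (2 powr (- \<gamma>))) * Lp_norm 1 \<mu> f"
proof -
  have pos: "geom_const (2 powr (- \<gamma>)) > 0" using \<gamma> by (intro geom_const_pos) auto
  have "weak_lp_norm 1 \<gamma> \<mu> (avg_seq 1 \<gamma> \<mu> f) \<le>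
      ennreal (geom_const (2 powr (- \<gamma>)) powr (1 / 1)) * ennpowr (Lp_norm 1 \<mu> f) (1 / 1)"
  proof (rule weak_lp_norm_le)
    fix t :: real and F assume t: "t > 0" and F: "finite F" "F \<subseteq> {Q\<in>dyadic_cubes. \<bar>avg_seq 1 \<gamma> \<mu> f Q\<bar> > t}"
    let ?w = "\<lambda>Q. ennreal (t powr 1) * (ennreal (sidelength Q powr (- \<gamma>)) * emeasure \<mu> Q)"
    show "sum ?w F \<le> ennreal (geom_const (2 powr (- \<gamma>))) * Lp_norm 1 \<mu> f"
    proof (rule packing_negative)
      fix P assume "P \<subseteq> F" "pairwise disjnt P"
      then show "sum ?w P \<le> Lp_norm 1 \<mu> f"
        using t F avg_seq_disjnt_le[OF f t, of P \<gamma>] finite_subset by auto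
    qed (use F \<gamma> borel_sets in auto)
  qed (use pos in auto)
  then show ?thesis
    using pos by (cases "Lp_norm 1 \<mu> f") (auto simp: ennpowr_def)
qed

lemma weak_type_doubling:
  assumes f: "locally_integrable \<mu> f" and \<gamma>: "d < \<gamma>"
    and c1: "\<And>Q. Q \<in> dyadic_cubes \<Longrightarrow> emeasure \<mu> Q \<le> ennreal c1 * ennreal (sidelength Q powr d)"
    and c2: "\<And>Q. Q \<in> dyadic_cubes \<Longrightarrow> ennreal (sidelength Q powr d) \<le> ennreal c2 * emeasure \<mu> Q"
    and c: "c1 > 0" "c2 > 0"
  shows "weak_lp_norm 1 \<gamma> \<mu> (avg_seq 1 \<gamma> \<mu> f) \<le> ennreal (c1 * c2 * geom_const (2 powr (d - \<gamma>))) * Lp_norm 1 \<mu> f"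
proof -
  let ?C = "c1 * c2 * geom_const (2 powr (d - \<gamma>))"
  have pos: "?C > 0" using \<gamma> c by (intro mult_pos_pos geom_const_pos) auto
  have "weak_lp_norm 1 \<gamma> \<mu> (avg_seq 1 \<gamma> \<mu> f) \<le> ennreal (?C powr (1 / 1)) * ennpowr (Lp_norm 1 \<mu> f) (1 / 1)"
  proof (rule weak_lp_norm_le)
    fix t :: real and F assume t: "t > 0" and F: "finite F" "F \<subseteq> {Q\<in>dyadic_cubes. \<bar>avg_seq 1 \<gamma> \<mu> f Q\<bar> > t}"
    let ?w = "\<lambda>Q. ennreal (t powr 1) * (ennreal (sidelength Q powr (- \<gamma>)) * emeasure \<mu> Q)"
    have "sum ?w F \<le> ennreal c1 * ennreal c2 * ennreal (geom_const (2 powr (d - \<gamma>))) * Lp_norm 1 \<mu> f"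
    proof (rule packing_doubling)
      fix P assume "P \<subseteq> F" "pairwise disjnt P"
      then show "sum ?w P \<le> Lp_norm 1 \<mu> f"
        using t F avg_seq_disjnt_le[OF f t, of P \<gamma>] finite_subset by auto
    qed (use F \<gamma> c1 c2 in auto)
    then show "sum ?w F \<le> ennreal ?C * Lp_norm 1 \<mu> f"
      using c by (simp add: ennreal_mult')
  qed (use pos in auto)
  then show ?thesis
    using pos by (cases "Lp_norm 1 \<mu> f") (auto simp: ennpowr_def)
qed

text \<open>The numbers \<tau>_k^(p-1) form a geometric progression with ratio 2^(-\<gamma>
  (p-1)/p), different from 1 because p > 1 and \<gamma> \<noteq> 0. Restricting to \<tau>_k < y
  bounds each term by y^(p-1), hence also the sum up to a constant.\<close>

lemma sum_fractional_powi_le: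
  fixes t y p \<gamma> :: real
  assumes p: "1 < p" and \<gamma>: "\<gamma> \<noteq> 0" and t: "0 < t" and y: "0 \<le> y" and K: "finite K"
  defines "\<tau> \<equiv> (\<lambda>k. t * (2 powr (- \<gamma> / p)) powi k)"
  shows "(\<Sum>k\<in>{k\<in>K. \<tau> k < y}. \<tau> k powr (p - 1)) \<le> geom_const (2 powr (- \<gamma> / p * (p - 1))) * y powr (p - 1)"
proof -
  define x :: real where "x = 2 powr (- \<gamma> / p * (p - 1))"
  have x: "x > 0" "x \<noteq> 1" using p \<gamma> by (auto simp: x_def powr_eq_one_iff_gen)
  have \<tau>: "\<tau> k powr (p - 1) = t powr (p - 1) * x powi k" for k
    using t by (simp add: \<tau>_def x_def powr_mult powi_powr powr_powr powr_real_of_int'[symmetric] mult_ac)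
  have "(\<Sum>k\<in>{k\<in>K. \<tau> k < y}. x powi k) \<le> geom_const x * (y powr (p - 1) / t powr (p - 1))"
  proof (rule sum_powi_le[OF x])
    fix k assume "k \<in> {k\<in>K. \<tau> k < y}"
    then have "\<tau> k powr (p - 1) \<le> y powr (p - 1)"
      using t p by (intro powr_mono2) (auto simp: \<tau>_def)
    then show "x powi k \<le> y powr (p - 1) / t powr (p - 1)"
      using t unfolding \<tau> by (simp add: field_simps)
  qed (use K in auto)
  then have "t powr (p - 1) * (\<Sum>k\<in>{k\<in>K. \<tau> k < y}. x powi k) \<le>
      t powr (p - 1) * (geom_const x * (y powr (p - 1) / t powr (p - 1)))"
    by (rule mult_left_mono) simp
  then show ?thesis
    using t unfolding \<tau> sum_distrib_left[symmetric] x_def[symmetric] by simp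
qed

text \<open>With \<open>\<tau>\<close> the threshold that the level \<open>t\<close> imposes on averages over cubes of generation \<open>k\<close>,
  half of the integral over a selected cube comes from the part of \<open>f\<close> above \<open>\<tau> / 2\<close>. So each
  generation separately satisfies a weak type bound, and these add up to the full \<open>L\<^sup>p\<close> norm because
  the thresholds form a geometric progression.\<close>

lemma weak_type_strong:
  assumes f: "locally_integrable \<mu> f" and \<gamma>: "\<gamma> \<noteq> 0" and p: "1 < p"
  shows "weak_lp_norm p \<gamma> \<mu> (avg_seq p \<gamma> \<mu> f) \<le>
    ennreal ((geom_const (2 powr (- \<gamma> / p * (p - 1))) * 2 powr p) powr (1 / p)) * Lp_norm p \<mu> f"
  unfolding Lp_norm_def
proof (rule weak_lp_norm_le)
  let ?C = "geom_const (2 powr (- \<gamma> / p * (p - 1)))"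
  have C: "?C > 0" using p \<gamma> by (intro geom_const_pos) (auto simp: powr_eq_one_iff_gen)
  then show "0 < ?C * 2 powr p" "0 < p" using p by auto
  have fm [measurable]: "f \<in> borel_measurable \<mu>" by (rule locally_integrable_measurable[OF f])
  fix t :: real and F assume t: "t > 0" and F: "finite F" "F \<subseteq> {Q\<in>dyadic_cubes. \<bar>avg_seq p \<gamma> \<mu> f Q\<bar> > t}"
  define \<tau> where "\<tau> = (\<lambda>k. t * (2 powr (- \<gamma> / p)) powi k)"
  have \<tau>: "\<tau> k > 0" for k using t by (simp add: \<tau>_def)
  have \<tau>Q: "t powr p * sidelength Q powr (- \<gamma>) = \<tau> (generation Q) powr p"
    "t * sidelength Q powr (- \<gamma> / p) = \<tau> (generation Q)" for Q :: "(real ^ 'n) set"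
    using t p by (simp_all add: \<tau>_def powr_mult sidelength_powr[symmetric] powr_powr)
  let ?w = "\<lambda>Q. ennreal (t powr p) * (ennreal (sidelength Q powr (- \<gamma>)) * emeasure \<mu> Q)"
  define h where "h = (\<lambda>k x. if \<tau> k < 2 * \<bar>f x\<bar> then ennreal \<bar>f x\<bar> else 0)"
  have hm [measurable]: "h k \<in> borel_measurable \<mu>" for k
    unfolding h_def by measurable
  \<comment> \<open>Where |f| is at most \<tau>/2 it contributes at most (\<tau>/2) \<mu>(Q), which
    is finite and can be cancelled. The factor 2 \<tau>^(p-1) turns the remaining (\<tau>/2)
    \<mu>(Q) into \<tau>^p \<mu>(Q), the term of Q.\<close>
  have w: "?w Q \<le> ennreal (2 * \<tau> (generation Q) powr (p - 1)) * (\<integral>\<^sup>+x\<in>Q. h (generation Q) x \<partial>\<mu>)"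
    if "Q \<in> F" for Q
  proof -
    let ?k = "generation Q"
    have Q [measurable]: "Q \<in> sets \<mu>" and fin: "emeasure \<mu> Q < \<infinity>" using that F cube_sets cube_finite by auto
    have "ennreal (\<tau> ?k) * emeasure \<mu> Q \<le> (\<integral>\<^sup>+x\<in>Q. ennreal \<bar>f x\<bar> \<partial>\<mu>)"
      using avg_seq_level[OF f _ t, of Q p \<gamma>] that F unfolding \<tau>Q by auto
    also have "\<dots> \<le> (\<integral>\<^sup>+x. h ?k x * indicator Q x + ennreal (\<tau> ?k / 2) * indicator Q x \<partial>\<mu>)"
      using \<tau>[of ?k] by (intro nn_integral_mono) (auto simp: h_def indicator_def intro!: ennreal_leI)
    also have "\<dots> = (\<integral>\<^sup>+x\<in>Q. h ?k x \<partial>\<mu>) + ennreal (\<tau> ?k / 2) * emeasure \<mu> Q"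
      by (simp add: nn_integral_add nn_integral_cmult_indicator)
    finally have *: "ennreal (\<tau> ?k) * emeasure \<mu> Q \<le> (\<integral>\<^sup>+x\<in>Q. h ?k x \<partial>\<mu>) + ennreal (\<tau> ?k / 2) * emeasure \<mu> Q" .
    have "ennreal (\<tau> ?k / 2) * emeasure \<mu> Q + ennreal (\<tau> ?k / 2) * emeasure \<mu> Q = ennreal (\<tau> ?k) * emeasure \<mu> Q"
      using \<tau>[of ?k] by (simp add: distrib_right[symmetric] ennreal_plus[symmetric] del: ennreal_plus)
    with * have "ennreal (\<tau> ?k / 2) * emeasure \<mu> Q + ennreal (\<tau> ?k / 2) * emeasure \<mu> Q \<le>
        ennreal (\<tau> ?k / 2) * emeasure \<mu> Q + (\<integral>\<^sup>+x\<in>Q. h ?k x \<partial>\<mu>)"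
      by (simp only: add.commute)
    moreover have "ennreal (\<tau> ?k / 2) * emeasure \<mu> Q \<noteq> top"
      using fin by (simp add: ennreal_mult_eq_top_iff less_top)
    ultimately have "ennreal (\<tau> ?k / 2) * emeasure \<mu> Q \<le> (\<integral>\<^sup>+x\<in>Q. h ?k x \<partial>\<mu>)"
      by (simp only: ennreal_add_left_cancel_le infinity_ennreal_def simp_thms)
    then have "ennreal (2 * \<tau> ?k powr (p - 1)) * (ennreal (\<tau> ?k / 2) * emeasure \<mu> Q) \<le>
        ennreal (2 * \<tau> ?k powr (p - 1)) * (\<integral>\<^sup>+x\<in>Q. h ?k x \<partial>\<mu>)"
      by (rule mult_left_mono) simp
    moreover have "ennreal (2 * \<tau> ?k powr (p - 1)) * ennreal (\<tau> ?k / 2) = ennreal (\<tau> ?k powr p)"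
      using \<tau>[of ?k] by (simp add: ennreal_mult'[symmetric] powr_diff)
    moreover have "?w Q = ennreal (\<tau> ?k powr p) * emeasure \<mu> Q"
      unfolding \<tau>Q(1)[symmetric] by (simp add: ennreal_mult' mult.assoc)
    ultimately show ?thesis by (simp add: mult.assoc[symmetric])
  qed
  let ?K = "generation ` F"
  have "sum ?w F \<le> (\<Sum>Q\<in>F. ennreal (2 * \<tau> (generation Q) powr (p - 1)) * (\<integral>\<^sup>+x\<in>Q. h (generation Q) x \<partial>\<mu>))"
    by (intro sum_mono w)
  also have "\<dots> = (\<Sum>k\<in>?K. \<Sum>Q | Q \<in> F \<and> generation Q = k.
      ennreal (2 * \<tau> (generation Q) powr (p - 1)) * (\<integral>\<^sup>+x\<in>Q. h (generation Q) x \<partial>\<mu>))"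
    by (rule sum.image_gen[OF F(1)])
  also have "\<dots> \<le> (\<Sum>k\<in>?K. ennreal (2 * \<tau> k powr (p - 1)) * (\<integral>\<^sup>+x. h k x \<partial>\<mu>))"
  proof (rule sum_mono)
    fix k assume "k \<in> ?K"
    let ?B = "{Q. Q \<in> F \<and> generation Q = k}"
    have "(\<Sum>Q\<in>?B. ennreal (2 * \<tau> (generation Q) powr (p - 1)) * (\<integral>\<^sup>+x\<in>Q. h (generation Q) x \<partial>\<mu>)) =
        ennreal (2 * \<tau> k powr (p - 1)) * (\<Sum>Q\<in>?B. \<integral>\<^sup>+x\<in>Q. h k x \<partial>\<mu>)"
      by (simp add: sum_distrib_left)
    also have "\<dots> \<le> ennreal (2 * \<tau> k powr (p - 1)) * (\<integral>\<^sup>+x. h k x \<partial>\<mu>)"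
      using F by (intro mult_left_mono sum_set_nn_integral_disjnt_le pairwise_disjnt_generation[where k = k]) auto
    finally show "(\<Sum>Q\<in>?B. ennreal (2 * \<tau> (generation Q) powr (p - 1)) * (\<integral>\<^sup>+x\<in>Q. h (generation Q) x \<partial>\<mu>))
      \<le> ennreal (2 * \<tau> k powr (p - 1)) * (\<integral>\<^sup>+x. h k x \<partial>\<mu>)" .
  qed
  also have "\<dots> = (\<integral>\<^sup>+x. (\<Sum>k\<in>?K. ennreal (2 * \<tau> k powr (p - 1)) * h k x) \<partial>\<mu>)"
    by (simp add: nn_integral_sum nn_integral_cmult)
  \<comment> \<open>At a fixed x only the generations with \<tau>_k < 2 |f x| contribute. Their sum
    is at most 2 |f x| times ?C (2 |f x|)^(p-1), which explains the constant ?C 2^p.\<close>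
  also have "\<dots> \<le> (\<integral>\<^sup>+x. ennreal (?C * 2 powr p) * ennreal (norm (f x) powr p) \<partial>\<mu>)"
  proof (rule nn_integral_mono)
    fix x
    have "(\<Sum>k\<in>?K. ennreal (2 * \<tau> k powr (p - 1)) * h k x) =
        (\<Sum>k\<in>?K. ennreal (if \<tau> k < 2 * \<bar>f x\<bar> then 2 * \<bar>f x\<bar> * \<tau> k powr (p - 1) else 0))"
      by (intro sum.cong) (auto simp: h_def ennreal_mult'[symmetric] mult_ac)
    also have "\<dots> = ennreal (2 * \<bar>f x\<bar> * (\<Sum>k\<in>{k\<in>?K. \<tau> k < 2 * \<bar>f x\<bar>}. \<tau> k powr (p - 1)))"
      using F(1) by (subst sum_ennreal) (auto simp: sum.inter_filter[symmetric] sum_distrib_left)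
    also have "\<dots> \<le> ennreal (2 * \<bar>f x\<bar> * (?C * (2 * \<bar>f x\<bar>) powr (p - 1)))"
      using F(1) sum_fractional_powi_le[OF p \<gamma> t, of "2 * \<bar>f x\<bar>" ?K]
      by (intro ennreal_leI mult_left_mono) (auto simp: \<tau>_def)
    also have "2 * \<bar>f x\<bar> * (?C * (2 * \<bar>f x\<bar>) powr (p - 1)) = ?C * 2 powr p * norm (f x) powr p"
      by (cases "f x = 0") (simp_all add: powr_diff powr_mult)
    finally show "(\<Sum>k\<in>?K. ennreal (2 * \<tau> k powr (p - 1)) * h k x) \<le>
        ennreal (?C * 2 powr p) * ennreal (norm (f x) powr p)"
      using C by (simp add: ennreal_mult')
  qed
  also have "\<dots> = ennreal (?C * 2 powr p) * (\<integral>\<^sup>+x. ennreal (norm (f x) powr p) \<partial>\<mu>)"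
    by (rule nn_integral_cmult) measurable
  finally show "sum ?w F \<le> ennreal (?C * 2 powr p) * (\<integral>\<^sup>+x. ennreal (norm (f x) powr p) \<partial>\<mu>)" .
qed

end

section \<open>Oscillation and the John-Nirenberg norm\<close>

text \<open>The counterpart of \<open>avg_seq_disjnt_le\<close> for oscillations: raising the level
  condition to the power p bounds the term of Q by |Q| O(f,Q)^p, the summand of the John-Nirenberg
  norm.\<close>

lemma osc_seq_disjnt_le:
  fixes f :: "real ^ 'n \<Rightarrow> real"
  assumes t: "t > 0" and p: "p \<ge> 1"
    and P: "finite P" "P \<subseteq> {Q\<in>dyadic_cubes. \<bar>osc_seq p \<gamma> lebesgue f Q\<bar> > t}" "pairwise disjnt P"
  shows "(\<Sum>Q\<in>P. ennreal (t powr p) * (ennreal (sidelength Q powr (- \<gamma>)) * emeasure lebesgue Q)) \<le>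
    (SUP P\<in>{P. P \<subseteq> dyadic_cubes \<and> pairwise disjnt P}.
       (\<integral>\<^sup>+Q. emeasure lebesgue Q * ennreal (mean_osc lebesgue f Q powr p) \<partial>count_space P))"
proof -
  have "(\<Sum>Q\<in>P. ennreal (t powr p) * (ennreal (sidelength Q powr (- \<gamma>)) * emeasure lebesgue Q)) \<le>
      (\<Sum>Q\<in>P. emeasure lebesgue Q * ennreal (mean_osc lebesgue f Q powr p))"
  proof (rule sum_mono)
    fix Q assume "Q \<in> P"
    then have Q: "t < \<bar>osc_seq p \<gamma> lebesgue f Q\<bar>" using P by auto
    have s: "sidelength Q > 0" by (simp add: sidelength_eq)
    have osc: "mean_osc lebesgue f Q \<ge> 0"
      unfolding mean_osc_def set_lebesgue_integral_def by (intro mult_nonneg_nonneg integral_nonneg_AE) auto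
    have "t powr p \<le> (sidelength Q powr (\<gamma> / p) * mean_osc lebesgue f Q) powr p"
      using Q osc t p by (intro powr_mono2) (auto simp: osc_seq_def)
    also have "\<dots> = sidelength Q powr \<gamma> * mean_osc lebesgue f Q powr p"
      using osc p by (simp add: powr_mult powr_powr)
    finally have "t powr p * sidelength Q powr (- \<gamma>) \<le> mean_osc lebesgue f Q powr p"
      using s by (simp add: powr_minus field_simps)
    then have "ennreal (t powr p * sidelength Q powr (- \<gamma>)) * emeasure lebesgue Q \<le>
        ennreal (mean_osc lebesgue f Q powr p) * emeasure lebesgue Q"
      by (intro mult_right_mono ennreal_leI) auto
    then show "ennreal (t powr p) * (ennreal (sidelength Q powr (- \<gamma>)) * emeasure lebesgue Q)
        \<le> emeasure lebesgue Q * ennreal (mean_osc lebesgue f Q powr p)"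
      by (simp add: ennreal_mult' mult_ac)
  qed
  also have "\<dots> = (\<integral>\<^sup>+Q. emeasure lebesgue Q * ennreal (mean_osc lebesgue f Q powr p) \<partial>count_space P)"
    using P by (simp add: nn_integral_count_space_finite)
  also have "\<dots> \<le> (SUP P\<in>{P. P \<subseteq> dyadic_cubes \<and> pairwise disjnt P}.
       (\<integral>\<^sup>+Q. emeasure lebesgue Q * ennreal (mean_osc lebesgue f Q powr p) \<partial>count_space P))"
    using P by (intro SUP_upper) auto
  finally show ?thesis .
qed

lemma Op_gamma_norm_le_JN_norm:
  fixes f :: "real ^ 'n \<Rightarrow> real"
  assumes p: "p \<ge> 1" and \<gamma>: "\<gamma> < 0 \<or> real CARD('n) < \<gamma>"
  shows "Op_gamma_norm p \<gamma> f \<le> ennreal (geom_const (if \<gamma> < 0 then 2 powr (- \<gamma>) else 2 powr (real CARD('n) - \<gamma>)) powr (1 / p)) * JN_norm p f"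
  unfolding Op_gamma_norm_def JN_norm_def
proof (rule weak_lp_norm_le)
  let ?C = "geom_const (if \<gamma> < 0 then 2 powr (- \<gamma>) else 2 powr (real CARD('n) - \<gamma>))"
  show "?C > 0" "0 < p" using p \<gamma> by (auto intro!: geom_const_pos)
  fix t :: real and F assume t: "t > 0" and F: "finite F" "F \<subseteq> {Q\<in>dyadic_cubes. \<bar>osc_seq p \<gamma> lebesgue f Q\<bar> > t}"
  let ?w = "\<lambda>Q. ennreal (t powr p) * (ennreal (sidelength Q powr (- \<gamma>)) * emeasure lebesgue Q)"
  let ?J = "SUP P\<in>{P. P \<subseteq> dyadic_cubes \<and> pairwise disjnt P}.
       (\<integral>\<^sup>+Q. emeasure lebesgue Q * ennreal (mean_osc lebesgue f Q powr p) \<partial>count_space P)"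
  have J: "sum ?w P \<le> ?J" if "P \<subseteq> F" "pairwise disjnt P" for P
    using that F by (intro osc_seq_disjnt_le[OF t p]) (auto intro: finite_subset)
  show "sum ?w F \<le> ennreal ?C * ?J"
  proof (cases "\<gamma> < 0")
    case True
    have "sum ?w F \<le> ennreal (geom_const (2 powr (- \<gamma>))) * ?J"
      by (rule packing_negative[where \<mu> = lebesgue]) (use J F True in auto)
    then show ?thesis using True by simp
  next
    case False
    have em: "emeasure lebesgue Q = ennreal (sidelength Q powr real CARD('n))" if "Q \<in> F" for Q
      using that F by (intro emeasure_lebesgue_dyadic) auto
    \<comment> \<open>The Lebesgue measure of a cube is exactly its side length to the power n, so d
      = n and both comparison constants are 1.\<close>
    have "sum ?w F \<le> ennreal 1 * ennreal 1 * ennreal (geom_const (2 powr (real CARD('n) - \<gamma>))) * ?J"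
      by (rule packing_doubling[where \<mu> = lebesgue])
        (use J F False \<gamma> em in auto)
    then show ?thesis using False by simp
  qed
qed

section \<open>Smooth test functions\<close>

text \<open>The derivative is an existential witness, so closure properties follow by exhibiting one
  and inducting. Order 0 asks for nothing, since continuity comes with the next derivative.\<close>

primrec times_differentiable :: "nat \<Rightarrow> (real \<Rightarrow> real) \<Rightarrow> bool" where
  "times_differentiable 0 f \<longleftrightarrow> True"
| "times_differentiable (Suc k) f \<longleftrightarrow>
     (\<exists>f'. (\<forall>x. (f has_real_derivative f' x) (at x)) \<and> times_differentiable k f')"

definition smooth :: "(real \<Rightarrow> real) \<Rightarrow> bool" where
  "smooth f \<longleftrightarrow> (\<forall>k. times_differentiable k f)"

lemma times_differentiable_SucI:
  "(\<And>x. (f has_real_derivative f' x) (at x)) \<Longrightarrow> times_differentiable k f' \<Longrightarrow> times_differentiable (Suc k) f"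
  by (auto intro: exI[of _ f'])

lemma times_differentiable_Suc_imp: "times_differentiable (Suc k) f \<Longrightarrow> times_differentiable k f"
  by (induction k arbitrary: f) (auto simp del: times_differentiable.simps(2) simp: times_differentiable.simps(2)[of _ f for f])

lemma times_differentiable_add:
  "times_differentiable k f \<Longrightarrow> times_differentiable k g \<Longrightarrow> times_differentiable k (\<lambda>x. f x + g x)"
proof (induction k arbitrary: f g)
  case (Suc k)
  then obtain f' g' where *: "\<And>x. (f has_real_derivative f' x) (at x)" "times_differentiable k f'"
    "\<And>x. (g has_real_derivative g' x) (at x)" "times_differentiable k g'" by auto
  then have D: "((\<lambda>x. f x + g x) has_real_derivative f' x + g' x) (at x)" for x
    by (auto intro!: derivative_eq_intros)
  show ?case by (rule times_differentiable_SucI[OF D Suc.IH[OF *(2,4)]])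
qed simp

lemma times_differentiable_mult:
  "times_differentiable k f \<Longrightarrow> times_differentiable k g \<Longrightarrow> times_differentiable k (\<lambda>x. f x * g x)"
proof (induction k arbitrary: f g)
  case (Suc k)
  then obtain f' g' where *: "\<And>x. (f has_real_derivative f' x) (at x)" "times_differentiable k f'"
    "\<And>x. (g has_real_derivative g' x) (at x)" "times_differentiable k g'" by auto
  then have D: "((\<lambda>x. f x * g x) has_real_derivative f' x * g x + f x * g' x) (at x)" for x
    by (auto intro!: derivative_eq_intros)
  have "times_differentiable k (\<lambda>x. f' x * g x + f x * g' x)"
    using Suc.IH[OF *(2) times_differentiable_Suc_imp[OF Suc.prems(2)]]
      Suc.IH[OF times_differentiable_Suc_imp[OF Suc.prems(1)] *(4)]
    by (rule times_differentiable_add)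
  then show ?case by (rule times_differentiable_SucI[OF D])
qed simp

text \<open>The factor c is there for the induction: the chain rule replaces it by c * a.\<close>

lemma times_differentiable_affine:
  "times_differentiable k f \<Longrightarrow> times_differentiable k (\<lambda>x. c * f (a * x + b))"
proof (induction k arbitrary: f c)
  case (Suc k)
  then obtain f' where *: "\<And>x. (f has_real_derivative f' x) (at x)" "times_differentiable k f'" by auto
  have D: "((\<lambda>x. c * f (a * x + b)) has_real_derivative (c * a) * f' (a * x + b)) (at x)" for x
    by (rule derivative_eq_intros DERIV_chain2[where f = f and g = "\<lambda>x. a * x + b"] * refl | simp)+
  show ?case by (rule times_differentiable_SucI[OF D Suc.IH[OF *(2)]])
qed simp

lemma smooth_mult: "smooth f \<Longrightarrow> smooth g \<Longrightarrow> smooth (\<lambda>x. f x * g x)"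
  by (simp add: smooth_def times_differentiable_mult)

lemma smooth_affine:
  assumes "smooth f"
  shows "smooth (\<lambda>x. f (a * x + b))"
  using assms times_differentiable_affine[of _ f 1 a b] by (simp add: smooth_def)

lemma smooth_diff_affine:
  assumes "smooth f" "smooth g"
  shows "smooth (\<lambda>x. f x - g (x - h))"
  unfolding smooth_def
proof
  fix k
  show "times_differentiable k (\<lambda>x. f x - g (x - h))"
    using times_differentiable_add[of k f "\<lambda>x. (- 1) * g (1 * x + (- h))"]
      times_differentiable_affine[of k g "- 1" 1 "- h"] assms
    by (simp add: smooth_def)
qed

text \<open>Each order k supplies its own derivative; uniqueness identifies all of them with a
  single f'.\<close>

lemma smooth_deriv:
  assumes "smooth f"
  shows "\<exists>f'. (\<forall>x. (f has_real_derivative f' x) (at x)) \<and> smooth f'"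
proof -
  obtain f' where f': "\<And>x. (f has_real_derivative f' x) (at x)"
    using assms unfolding smooth_def by (metis times_differentiable.simps(2))
  have "times_differentiable k f'" for k
  proof -
    have "times_differentiable (Suc k) f" using assms by (simp add: smooth_def del: times_differentiable.simps)
    then obtain g where g: "\<And>x. (f has_real_derivative g x) (at x)" "times_differentiable k g" by auto
    have "g = f'" using g(1) f' DERIV_unique by blast
    then show ?thesis using g by simp
  qed
  then have "smooth f'" by (simp add: smooth_def)
  then show ?thesis using f' by (intro exI[of _ f'] conjI allI)
qed

lemma smooth_antiderivative:
  assumes "\<And>x. (F has_real_derivative f x) (at x)" "smooth f"
  shows "smooth F"
  unfolding smooth_def
proof
  fix k show "times_differentiable k F"
    using assms by (cases k) (auto simp: smooth_def)
qed

lemma smooth_continuous: "smooth f \<Longrightarrow> isCont f x"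
  by (metis smooth_deriv DERIV_isCont)

section \<open>Flat functions and one-dimensional bumps\<close>

lemma tendsto_poly_times_exp_minus: "((\<lambda>x. poly q x * exp (- x)) \<longlongrightarrow> (0::real)) at_top"
proof -
  have "((\<lambda>x. \<Sum>i\<le>degree q. coeff q i * (x ^ i / exp x)) \<longlongrightarrow> (\<Sum>i\<le>degree q. coeff q i * 0)) at_top"
    by (intro tendsto_intros tendsto_power_div_exp_0)
  moreover have "(\<Sum>i\<le>degree q. coeff q i * (x ^ i / exp x)) = poly q x * exp (- x)" for x :: real
    by (simp add: poly_altdef sum_distrib_right exp_minus divide_inverse mult.assoc)
  ultimately show ?thesis by simp
qed

text \<open>\<open>flat 1\<close> is the classical exp (- 1/x) extended by 0. The polynomial factor
  in 1/x makes the family closed under differentiation.\<close>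

definition flat :: "real poly \<Rightarrow> real \<Rightarrow> real" where
  "flat q x = (if x > 0 then poly q (1 / x) * exp (- (1 / x)) else 0)"

text \<open>Differentiating q(1/x) exp (- 1/x) gives (q - q')(1/x) exp (- 1/x) / x^2, and
  \<open>[:0, 0, 1:]\<close> is the square in the variable 1/x. At 0 the right difference quotient
  is again polynomial times exponential decay in 1/h and tends to 0.\<close>

lemma flat_has_derivative:
  "(flat q has_real_derivative flat ([:0, 0, 1:] * (q - pderiv q)) x) (at x)"
proof (cases x "0 :: real" rule: linorder_cases)
  case less
  have "(flat q has_real_derivative 0) (at x)"
    by (rule has_field_derivative_transform_within_open[where f = "\<lambda>_. 0" and S = "{..<0}"])
      (use less in \<open>auto simp: flat_def\<close>)
  then show ?thesis using less by (simp add: flat_def)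
next
  case equal
  have "((\<lambda>h. flat q h / h) \<longlongrightarrow> 0) (at_right 0)"
  proof (rule Lim_transform_eventually)
    show "((\<lambda>h. poly (pCons 0 q) (inverse h) * exp (- inverse h)) \<longlongrightarrow> 0) (at_right (0::real))"
      by (rule filterlim_compose[OF tendsto_poly_times_exp_minus filterlim_inverse_at_top_right])
    show "\<forall>\<^sub>F h in at_right 0. poly (pCons 0 q) (inverse h) * exp (- inverse h) = flat q h / h"
      by (auto simp: eventually_at_filter flat_def field_simps)
  qed
  moreover have "((\<lambda>h. flat q h / h) \<longlongrightarrow> 0) (at_left 0)"
    by (rule Lim_transform_eventually[OF tendsto_const]) (auto simp: eventually_at_filter flat_def)
  ultimately have "((\<lambda>h. flat q h / h) \<longlongrightarrow> 0) (at 0)"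
    by (simp add: filterlim_split_at)
  then show ?thesis using equal by (simp add: has_field_derivative_iff flat_def)
next
  case greater
  have "((\<lambda>x. poly q (1 / x) * exp (- (1 / x))) has_real_derivative
      poly ([:0, 0, 1:] * (q - pderiv q)) (1 / x) * exp (- (1 / x))) (at x)"
    using greater
    by (auto intro!: derivative_eq_intros DERIV_chain2[OF poly_DERIV] simp: field_simps power2_eq_square)
  then have "(flat q has_real_derivative poly ([:0, 0, 1:] * (q - pderiv q)) (1 / x) * exp (- (1 / x))) (at x)"
    by (rule has_field_derivative_transform_within_open[where S = "{0<..}"])
      (use greater in \<open>auto simp: flat_def\<close>)
  then show ?thesis using greater by (simp add: flat_def)
qed

lemma smooth_flat: "smooth (flat q)"
proof -
  have "times_differentiable k (flat q)" for k
    by (induction k arbitrary: q) (auto intro: flat_has_derivative)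
  then show ?thesis by (simp add: smooth_def)
qed

text \<open>Since \<open>exp (- 1 / (n x)) \<longlongrightarrow> 1\<close> for \<open>x > 0\<close>, dilating instead of mollifying already yields
  smooth approximations of the indicator of an interval, all with the same support.\<close>

definition bump :: "nat \<Rightarrow> real \<Rightarrow> real \<Rightarrow> real \<Rightarrow> real" where
  "bump n a b x = flat 1 (real (Suc n) * (x - a)) * flat 1 (real (Suc n) * (b - x))"

lemma smooth_bump: "smooth (bump n a b)"
proof -
  have "smooth (\<lambda>x. flat 1 (real (Suc n) * x + (- real (Suc n) * a)) * flat 1 ((- real (Suc n)) * x + real (Suc n) * b))"
    by (intro smooth_mult smooth_affine smooth_flat)
  also have "(\<lambda>x. flat 1 (real (Suc n) * x + (- real (Suc n) * a)) * flat 1 ((- real (Suc n)) * x + real (Suc n) * b)) = bump n a b"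
    by (simp add: bump_def fun_eq_iff algebra_simps)
  finally show ?thesis .
qed

lemma flat_1_bounds: "0 \<le> flat 1 x" "flat 1 x \<le> 1"
  by (auto simp: flat_def)

lemma bump_bounds: "0 \<le> bump n a b x" "bump n a b x \<le> 1"
  using flat_1_bounds by (auto simp: bump_def intro: mult_le_one)

lemma bump_eq_0: "x \<notin> {a<..<b} \<Longrightarrow> bump n a b x = 0"
  by (auto simp: bump_def flat_def mult_le_0_iff zero_less_mult_iff not_less)

lemma tendsto_flat_1:
  assumes "x > 0"
  shows "(\<lambda>n. flat 1 (real (Suc n) * x)) \<longlonglongrightarrow> 1"
proof -
  have "(\<lambda>n. exp (- (inverse (real (Suc n)) * inverse x))) \<longlonglongrightarrow> exp (- (0 * inverse x))"
    by (intro tendsto_intros LIMSEQ_inverse_real_of_nat)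
  then show ?thesis using assms by (simp add: flat_def divide_inverse del: of_nat_Suc)
qed

lemma tendsto_bump: "(\<lambda>n. bump n a b x) \<longlonglongrightarrow> indicat_real {a<..<b} x"
proof (cases "x \<in> {a<..<b}")
  case True
  then have "(\<lambda>n. bump n a b x) \<longlonglongrightarrow> 1 * 1"
    unfolding bump_def by (intro tendsto_mult tendsto_flat_1) auto
  then show ?thesis using True by simp
qed (simp add: bump_eq_0)

section \<open>Products of one-dimensional functions as test functions\<close>

definition tensor :: "('n::finite \<Rightarrow> real \<Rightarrow> real) \<Rightarrow> real ^ 'n \<Rightarrow> real" where
  "tensor \<phi> x = (\<Prod>i\<in>UNIV. \<phi> i (x $ i))"

lemma tensor_has_derivative:
  assumes "\<And>i x. (\<phi> i has_real_derivative \<phi>' i x) (at x)"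
  shows "(tensor \<phi> has_derivative (\<lambda>y. \<Sum>i\<in>UNIV. \<phi>' i (x $ i) * y $ i * (\<Prod>j\<in>UNIV - {i}. \<phi> j (x $ j)))) (at x)"
proof -
  have "((\<lambda>x. \<phi> i (x $ i)) has_derivative (\<lambda>y. \<phi>' i (x $ i) * y $ i)) (at x)" for i
    using has_derivative_compose[of "\<lambda>x. x $ i" "\<lambda>y. y $ i" x UNIV "\<phi> i" "\<lambda>y. \<phi>' i (x $ i) * y"] assms
    by (auto simp: has_field_derivative_def bounded_linear_imp_has_derivative bounded_linear_vec_nth)
  then show ?thesis unfolding tensor_def[abs_def] by (rule has_derivative_prod)
qed

lemma tensor_fun_upd: "tensor (\<phi>(i := \<psi>)) x = \<psi> (x $ i) * (\<Prod>j\<in>UNIV - {i}. \<phi> j (x $ j))"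
  unfolding tensor_def by (subst prod.remove[of UNIV i]) (auto intro!: prod.cong)

lemma partial_deriv_tensor:
  assumes "\<And>j x. (\<phi> j has_real_derivative \<phi>' j x) (at x)"
  shows "partial_deriv i (tensor \<phi>) = tensor (\<phi>(i := \<phi>' i))"
proof
  fix x
  have "frechet_derivative (tensor \<phi>) (at x) = (\<lambda>y. \<Sum>i\<in>UNIV. \<phi>' i (x $ i) * y $ i * (\<Prod>j\<in>UNIV - {i}. \<phi> j (x $ j)))"
    by (rule frechet_derivative_at[symmetric]) (rule tensor_has_derivative[OF assms])
  then have "partial_deriv i (tensor \<phi>) x =
      (\<Sum>k\<in>UNIV. if k = i then \<phi>' i (x $ i) * (\<Prod>j\<in>UNIV - {i}. \<phi> j (x $ j)) else 0)"
    unfolding partial_deriv_def by (simp only:) (rule sum.cong, auto simp: axis_def)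
  then show "partial_deriv i (tensor \<phi>) x = tensor (\<phi>(i := \<phi>' i)) x"
    by (simp add: tensor_fun_upd)
qed

text \<open>A partial derivative of a product is again such a product, with one factor
  differentiated. The induction therefore runs over all smooth families of factors at once.\<close>

lemma Ck_tensor:
  assumes "\<And>i. smooth (\<phi> i)"
  shows "Ck k (tensor \<phi>)"
  using assms
proof (induction k arbitrary: \<phi>)
  case 0
  have "continuous_on UNIV (\<phi> i)" for i
    using smooth_continuous[OF 0] by (simp add: continuous_at_imp_continuous_on)
  then have "continuous_on UNIV (\<lambda>x :: real ^ 'a. \<phi> i (x $ i))" for i
    by (rule continuous_on_compose2) (auto intro!: continuous_intros)
  then show ?case unfolding tensor_def[abs_def]
    by (simp add: continuous_on_prod)
next
  case (Suc k)
  have "\<exists>\<phi>'. (\<forall>x. (\<phi> i has_real_derivative \<phi>' x) (at x)) \<and> smooth \<phi>'" for i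
    by (rule smooth_deriv[OF Suc.prems])
  then have "\<exists>\<phi>'. \<forall>i. (\<forall>x. (\<phi> i has_real_derivative \<phi>' i x) (at x)) \<and> smooth (\<phi>' i)"
    by (rule choice[OF allI])
  then obtain \<phi>' where \<phi>': "\<And>i x. (\<phi> i has_real_derivative \<phi>' i x) (at x)" "\<And>i. smooth (\<phi>' i)" by blast
  have "Ck k (partial_deriv i (tensor \<phi>))" for i
    unfolding partial_deriv_tensor[OF \<phi>'(1)] by (rule Suc.IH) (use Suc.prems \<phi>' in auto)
  moreover have "tensor \<phi> differentiable (at x)" for x
    unfolding differentiable_def by (rule exI) (rule tensor_has_derivative[of \<phi>, OF \<phi>'(1)])
  ultimately show ?case by simp
qed

lemma test_function_tensor:
  assumes "\<And>i. smooth (\<phi> i)" and supp: "\<And>i t. t \<notin> {a $ i..b $ i} \<Longrightarrow> \<phi> i t = 0"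
  shows "test_function (tensor \<phi>)"
proof -
  have "{x. tensor \<phi> x \<noteq> 0} \<subseteq> cbox a b"
    using supp by (auto simp: tensor_def mem_box_cart) (meson linorder_not_le)+
  then have "bounded {x. tensor \<phi> x \<noteq> 0}"
    using bounded_cbox bounded_subset by blast
  moreover have "Ck k (tensor \<phi>)" for k
    by (rule Ck_tensor) (rule assms(1))
  ultimately show ?thesis
    by (simp add: test_function_def)
qed

section \<open>Weak partial derivatives and translations\<close>

lemma lborel_integral_translate:
  fixes H :: "'a::euclidean_space \<Rightarrow> real"
  assumes [measurable]: "H \<in> borel_measurable borel"
  shows "(\<integral>x. H (x + v) \<partial>lborel) = (\<integral>x. H x \<partial>lborel)"
proof -
  have "(\<integral>x. H x \<partial>lborel) = (\<integral>x. H x \<partial>distr lborel borel ((+) v))"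
    by (simp add: lborel_distr_plus)
  also have "\<dots> = (\<integral>x. H (v + x) \<partial>lborel)"
    by (rule integral_distr) measurable
  finally show ?thesis by (simp add: add.commute)
qed

lemma lborel_integrable_translate:
  fixes H :: "'a::euclidean_space \<Rightarrow> real"
  assumes "integrable lborel H"
  shows "integrable lborel (\<lambda>x. H (x + v))"
proof -
  have "integrable (distr lborel borel ((+) v)) H"
    using assms by (simp add: lborel_distr_plus)
  then have "integrable lborel (\<lambda>x. H (v + x))"
    by (subst (asm) integrable_distr_eq) (use borel_measurable_integrable[OF assms] in auto)
  then show ?thesis by (simp add: add.commute)
qed

lemma lborel_nn_integral_translate:
  fixes H :: "'a::euclidean_space \<Rightarrow> ennreal"
  assumes [measurable]: "H \<in> borel_measurable borel"
  shows "(\<integral>\<^sup>+x. H (x + v) \<partial>lborel) = (\<integral>\<^sup>+x. H x \<partial>lborel)"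
proof -
  have "(\<integral>\<^sup>+x. H x \<partial>lborel) = (\<integral>\<^sup>+x. H x \<partial>distr lborel borel ((+) v))"
    by (simp add: lborel_distr_plus)
  also have "\<dots> = (\<integral>\<^sup>+x. H (v + x) \<partial>lborel)"
    by (rule nn_integral_distr) measurable
  finally show ?thesis by (simp add: add.commute)
qed

lemma borel_eq_sigma_sets_box:
  "sets (borel :: 'a::euclidean_space measure) = sigma_sets UNIV (range (\<lambda>(a, b). box a b))"
  by (subst borel_eq_box) (simp add: sets_measure_of)

text \<open>Open boxes are stable under intersection and generate the Borel sets. The sets over
  which v integrates to 0 are closed under complements and disjoint unions, so they include every
  Borel set.\<close>

lemma AE_eq_0_of_box_integrals:
  fixes v :: "'a::euclidean_space \<Rightarrow> real"
  assumes v: "integrable lborel v" and box: "\<And>a b. (\<integral>x. indicator (box a b) x * v x \<partial>lborel) = 0"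
  shows "AE x in lborel. v x = 0"
proof (rule density_unique_real)
  fix A :: "'a set" assume "A \<in> sets lborel"
  then have "A \<in> sigma_sets UNIV (range (\<lambda>(a, b). box a b))"
    using borel_eq_sigma_sets_box by auto
  have int: "integrable lborel (\<lambda>x. indicator A x * v x)" if "A \<in> sigma_sets UNIV (range (\<lambda>(a, b). box a b))" for A
    using integrable_mult_indicator[OF _ v, of A] that borel_eq_sigma_sets_box by auto
  \<comment> \<open>Complements require the integral over the whole space, which is a limit of
    integrals over growing boxes.\<close>
  have univ: "(\<integral>x. v x \<partial>lborel) = 0"
  proof -
    have "(\<lambda>n::nat. \<integral>x. indicator (box (- (real n *\<^sub>R One)) (real n *\<^sub>R One)) x * v x \<partial>lborel) \<longlonglongrightarrow> (\<integral>x. v x \<partial>lborel)"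
    proof (rule integral_dominated_convergence[where w = "\<lambda>x. \<bar>v x\<bar>"])
      show "AE x in lborel. (\<lambda>n. indicator (box (- (real n *\<^sub>R One)) (real n *\<^sub>R One)) x * v x) \<longlonglongrightarrow> v x"
      proof (rule AE_I2)
        fix x :: 'a
        obtain N where N: "x \<in> box (- (real N *\<^sub>R One)) (real N *\<^sub>R One)"
          using UN_box_eq_UNIV[where 'a = 'a] by blast
        have "x \<in> box (- (real n *\<^sub>R One)) (real n *\<^sub>R One)" if "n \<ge> N" for n
          using N that by (force simp: box_def)
        then show "(\<lambda>n. indicator (box (- (real n *\<^sub>R One)) (real n *\<^sub>R One)) x * v x) \<longlonglongrightarrow> v x"
          by (intro tendsto_eventually eventually_sequentiallyI[of N]) auto
      qed
    qed (use v in \<open>auto simp: indicator_def borel_measurable_integrable\<close>)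
    then show ?thesis using box LIMSEQ_unique[OF _ tendsto_const] by fastforce
  qed
  have stable: "Int_stable (range (\<lambda>(a, b). box a b :: 'a set))"
  proof (clarsimp simp: Int_stable_def)
    fix a b c d :: 'a
    show "box a b \<inter> box c d \<in> range (\<lambda>(a, b). box a b)"
      unfolding box_Int_box by (rule range_eqI[where x = "(_, _)"]) simp
  qed
  have generators: "range (\<lambda>(a, b). box a b :: 'a set) \<subseteq> Pow UNIV" by simp
  have "(\<integral>x. indicator A x * v x \<partial>lborel) = 0"
    using stable generators \<open>A \<in> sigma_sets UNIV (range (\<lambda>(a, b). box a b))\<close>
  proof (induction rule: sigma_sets_induct_disjoint)
    case (compl A)
    have "(\<integral>x. indicator (UNIV - A) x * v x \<partial>lborel) = (\<integral>x. v x - indicator A x * v x \<partial>lborel)"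
      by (intro Bochner_Integration.integral_cong) (auto simp: indicator_def)
    then show ?case using compl int v univ by simp
  next
    case (union A)
    have "(\<lambda>n. \<integral>x. (\<Sum>k<n. indicator (A k) x * v x) \<partial>lborel) \<longlonglongrightarrow> (\<integral>x. indicator (\<Union>i. A i) x * v x \<partial>lborel)"
    proof (rule integral_dominated_convergence[where w = "\<lambda>x. \<bar>v x\<bar>"])
      have meas: "A k \<in> sets borel" for k using union(2) borel_eq_sigma_sets_box by auto
      then have [measurable]: "v \<in> borel_measurable borel" "A k \<in> sets borel" for k using v by auto
      show "(\<lambda>x. indicat_real (\<Union>i. A i) x * v x) \<in> borel_measurable lborel"
        "(\<lambda>x. \<Sum>k<n. indicat_real (A k) x * v x) \<in> borel_measurable lborel" for n
        by measurable
      show "integrable lborel (\<lambda>x. \<bar>v x\<bar>)" using v by simp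
      \<comment> \<open>By disjointness the partial sums are indicators, so |v| dominates all of
        them.\<close>
      have eq: "(\<Sum>k<n. indicat_real (A k) x) = indicat_real (\<Union>k<n. A k) x" for n x
        using union(1) by (subst indicator_UN_disjoint) (auto simp: disjoint_family_on_def)
      have "(\<lambda>n. indicat_real (\<Union>k<n. A k) x) \<longlonglongrightarrow> indicat_real (\<Union>i. A i) x" for x
        by (rule LIMSEQ_indicator_UN)
      then show "AE x in lborel. (\<lambda>n. \<Sum>k<n. indicat_real (A k) x * v x) \<longlonglongrightarrow> indicat_real (\<Union>i. A i) x * v x"
        unfolding sum_distrib_right[symmetric] eq by (intro AE_I2 tendsto_mult tendsto_const)
      show "AE x in lborel. norm (\<Sum>k<n. indicat_real (A k) x * v x) \<le> \<bar>v x\<bar>" for n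
        unfolding sum_distrib_right[symmetric] eq by (auto simp: indicator_def)
    qed
    moreover have "(\<integral>x. (\<Sum>k<n. indicator (A k) x * v x) \<partial>lborel) = 0" for n
      using union int by (subst Bochner_Integration.integral_sum) auto
    ultimately show ?case using LIMSEQ_unique[OF _ tendsto_const] by fastforce
  qed (use box in auto)
  then show "set_lebesgue_integral lborel A v = set_lebesgue_integral lborel A (\<lambda>x. 0)"
    by (simp add: set_lebesgue_integral_def)
qed (use v in auto)

section \<open>Differences of a function as line integrals of its weak derivative\<close>

text \<open>One direction of a weak gradient, for Borel representatives with respect to
  \<open>lborel\<close>, where translations and product measures are available.\<close>

locale weak_partial =
  fixes f g :: "real ^ 'n \<Rightarrow> real" and i :: 'n
  assumes f_borel [measurable]: "f \<in> borel_measurable borel"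
    and g_borel [measurable]: "g \<in> borel_measurable borel"
    and f_int: "\<And>a b. integrable lborel (\<lambda>x. indicator (cbox a b) x * f x)"
    and g_int: "\<And>a b. integrable lborel (\<lambda>x. indicator (cbox a b) x * g x)"
    and weak: "\<And>\<phi>. test_function \<phi> \<Longrightarrow>
      (\<integral>x. f x * partial_deriv i \<phi> x \<partial>lborel) = - (\<integral>x. g x * \<phi> x \<partial>lborel)"
begin

abbreviation e :: "real ^ 'n" where "e \<equiv> axis i 1"

text \<open>For a box A, this is the time that the backward segment from x of length h spends in A.
  It arises as the limit of test functions and is dual to \<open>line_integral\<close>.\<close>

definition path_measure :: "real \<Rightarrow> (real ^ 'n) set \<Rightarrow> real ^ 'n \<Rightarrow> real" where
  "path_measure h A x = (\<integral>t. indicator {0..h} t * indicator A (x - t *\<^sub>R e) \<partial>lborel)"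

lemma swept_box:
  assumes "0 \<le> t" "t \<le> h" "x - t *\<^sub>R e \<in> box a b"
  shows "x \<in> cbox a (b + h *\<^sub>R e)"
  unfolding mem_box_cart
proof
  fix j
  have "a $ j < (x - t *\<^sub>R e) $ j" "(x - t *\<^sub>R e) $ j < b $ j" using assms(3) by (auto simp: mem_box_cart)
  then show "a $ j \<le> x $ j \<and> x $ j \<le> (b + h *\<^sub>R e) $ j"
    using assms(1,2) by (auto simp: axis_def split: if_splits)
qed

text \<open>The test function is chosen so that its i-th derivative is the difference of \<psi> and
  its translate: the i-th factor of \<psi> is replaced by its average \<Psi> over backward shifts,
  without normalization.\<close>

lemma test_identity:
  fixes n :: nat and a b :: "real ^ 'n"
  assumes h: "0 \<le> h"
  defines "\<psi> \<equiv> tensor (\<lambda>j. bump n (a $ j) (b $ j))"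
  shows "(\<integral>x. f x * (\<psi> x - \<psi> (x - h *\<^sub>R e)) \<partial>lborel) =
    - (\<integral>x. g x * (\<integral>t. indicator {0..h} t * \<psi> (x - t *\<^sub>R e) \<partial>lborel) \<partial>lborel)"
proof -
  define \<beta> where "\<beta> = (\<lambda>j. bump n (a $ j) (b $ j))"
  have \<psi>: "\<psi> = tensor \<beta>" by (simp add: \<psi>_def \<beta>_def)
  have s\<beta>: "smooth (\<beta> j)" for j by (simp add: \<beta>_def smooth_bump)
  have "\<exists>B. \<forall>s::real. -\<infinity> < ereal s \<longrightarrow> ereal s < \<infinity> \<longrightarrow> (B has_vector_derivative \<beta> i s) (at s)"
    by (rule einterval_antiderivative) (use smooth_continuous[OF s\<beta>] in auto)
  then obtain B where B: "(B has_real_derivative \<beta> i s) (at s)" for s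
    by (auto simp: has_real_derivative_iff_has_vector_derivative)
  \<comment> \<open>A primitive B of the bump is in general not compactly supported, but the
    difference of B and its translate is.\<close>
  define \<Psi> where "\<Psi> = (\<lambda>s. B s - B (s - h))"
  have D\<Psi>: "(\<Psi> has_real_derivative \<beta> i s - \<beta> i (s - h)) (at s)" for s
    unfolding \<Psi>_def by (auto intro!: derivative_eq_intros DERIV_chain2[OF B] B)
  \<comment> \<open>This form shows both the compact support of \<Psi> and the identity of the test
    function with the inner integral in the claim.\<close>
  have \<Psi>: "\<Psi> s = (\<integral>t. \<beta> i (s - t) * indicator {0..h} t \<partial>lborel)" for s
  proof -
    have "(\<integral>t. \<beta> i (s - t) * indicator {0..h} t \<partial>lborel) = - B (s - h) - (- B (s - 0))"
    proof (rule integral_FTC_Icc_real)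
      show "((\<lambda>t. - B (s - t)) has_real_derivative \<beta> i (s - t)) (at t)" for t
        by (auto intro!: derivative_eq_intros DERIV_chain2[OF B])
      show "isCont (\<lambda>t. \<beta> i (s - t)) t" for t
        by (intro isCont_o2[OF _ smooth_continuous[OF s\<beta>]] continuous_intros)
    qed (use h in auto)
    then show ?thesis by (simp add: \<Psi>_def)
  qed
  define \<phi> where "\<phi> = \<beta>(i := \<Psi>)"
  have s\<phi>: "smooth (\<phi> j)" for j
    using s\<beta> smooth_diff_affine[of B B h] smooth_antiderivative[OF B s\<beta>] by (simp add: \<phi>_def \<Psi>_def)
  have test: "test_function (tensor \<phi>)"
  proof (rule test_function_tensor[OF s\<phi>, of a "b + h *\<^sub>R e"])
    fix j t assume t: "t \<notin> {a $ j..(b + h *\<^sub>R e) $ j}"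
    show "\<phi> j t = 0"
    proof (cases "j = i")
      case True
      have "\<beta> i (t - s) * indicator {0..h} s = 0" for s
        using t True by (auto simp: \<beta>_def indicator_def axis_def intro!: bump_eq_0)
      then show ?thesis
        using True unfolding \<phi>_def by (simp only: \<Psi> fun_upd_same Bochner_Integration.integral_zero)
    next
      case False
      then show ?thesis using t by (auto simp: \<phi>_def \<beta>_def axis_def intro!: bump_eq_0)
    qed
  qed
  define R where "R = (\<lambda>x :: real ^ 'n. \<Prod>j\<in>UNIV - {i}. \<beta> j (x $ j))"
  have \<psi>R: "\<psi> (x - t *\<^sub>R e) = \<beta> i (x $ i - t) * R x" for x t
    using tensor_fun_upd[of \<beta> i "\<beta> i" "x - t *\<^sub>R e"]
    by (simp add: \<psi> R_def axis_def cong: prod.cong_simp)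
  have tens: "tensor \<phi> x = (\<integral>t. indicator {0..h} t * \<psi> (x - t *\<^sub>R e) \<partial>lborel)" for x
  proof -
    have "tensor \<phi> x = \<Psi> (x $ i) * R x"
      by (simp add: \<phi>_def tensor_fun_upd R_def)
    also have "\<dots> = (\<integral>t. \<beta> i (x $ i - t) * indicator {0..h} t * R x \<partial>lborel)"
      by (simp add: \<Psi>)
    finally show ?thesis by (simp add: \<psi>R mult_ac)
  qed
  define \<phi>' where "\<phi>' = (\<lambda>j. if j = i then (\<lambda>s. \<beta> i s - \<beta> i (s - h)) else deriv (\<beta> j))"
  have "(\<beta> j has_real_derivative deriv (\<beta> j) s) (at s)" for j s
    by (metis smooth_deriv s\<beta> DERIV_imp_deriv)
  then have "(\<phi> j has_real_derivative \<phi>' j s) (at s)" for j s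
    using D\<Psi> by (simp add: \<phi>_def \<phi>'_def)
  then have "partial_deriv i (tensor \<phi>) = tensor (\<phi>(i := \<phi>' i))"
    by (rule partial_deriv_tensor)
  also have "\<dots> = (\<lambda>x. \<psi> x - \<psi> (x - h *\<^sub>R e))"
  proof
    fix x
    have "tensor (\<phi>(i := \<phi>' i)) x = (\<beta> i (x $ i) - \<beta> i (x $ i - h)) * R x"
      by (simp add: \<phi>_def \<phi>'_def tensor_fun_upd R_def)
    then show "tensor (\<phi>(i := \<phi>' i)) x = \<psi> x - \<psi> (x - h *\<^sub>R e)"
      using \<psi>R[of x 0] \<psi>R[of x h] by (simp add: algebra_simps)
  qed
  finally show ?thesis using weak[OF test] by (simp add: tens)
qed

lemma tendsto_tensor_bump:
  "(\<lambda>n. tensor (\<lambda>j. bump n (a $ j) (b $ j)) x) \<longlonglongrightarrow> indicat_real (box a b) x"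
proof -
  have "(\<lambda>n. tensor (\<lambda>j. bump n (a $ j) (b $ j)) x) \<longlonglongrightarrow> (\<Prod>j\<in>UNIV. indicat_real {a $ j<..<b $ j} (x $ j))"
    unfolding tensor_def by (intro tendsto_prod tendsto_bump)
  also have "(\<Prod>j\<in>UNIV. indicat_real {a $ j<..<b $ j} (x $ j)) = indicat_real (box a b) x"
    by (auto simp: indicator_def mem_box_cart)
  finally show ?thesis .
qed

lemma tensor_bump_bounds:
  "0 \<le> tensor (\<lambda>j. bump n (a $ j) (b $ j)) x" "tensor (\<lambda>j. bump n (a $ j) (b $ j)) x \<le> indicat_real (box a b) x"
proof -
  show "0 \<le> tensor (\<lambda>j. bump n (a $ j) (b $ j)) x"
    unfolding tensor_def by (intro prod_nonneg) (simp add: bump_bounds)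
  show "tensor (\<lambda>j. bump n (a $ j) (b $ j)) x \<le> indicat_real (box a b) x"
  proof (cases "x \<in> box a b")
    case True
    then show ?thesis
      unfolding tensor_def by (simp add: prod_le_1 bump_bounds)
  next
    case False
    then obtain j where "x $ j \<notin> {a $ j<..<b $ j}" by (auto simp: mem_box_cart)
    then have "bump n (a $ j) (b $ j) (x $ j) = 0" by (rule bump_eq_0)
    then have "tensor (\<lambda>j. bump n (a $ j) (b $ j)) x = 0"
      unfolding tensor_def by (intro prod_zero) auto
    then show ?thesis by simp
  qed
qed

lemma tensor_bump_measurable [measurable]:
  "tensor (\<lambda>j. bump n (a $ j) (b $ j)) \<in> borel_measurable borel"
proof -
  have "Ck 0 (tensor (\<lambda>j. bump n (a $ j) (b $ j)))"
    by (rule Ck_tensor) (rule smooth_bump)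
  then show ?thesis by (simp add: borel_measurable_continuous_onI)
qed

text \<open>\<open>test_identity\<close> passes to the limit by dominated convergence, since all
  bumps live in the same box and their shifts in one enlarged closed box. The factor h in the second
  majorant is the length of the segment.\<close>

lemma box_identity:
  assumes h: "0 \<le> h"
  shows "(\<integral>x. f x * (indicator (box a b) x - indicator (box a b) (x - h *\<^sub>R e)) \<partial>lborel) =
    - (\<integral>x. g x * path_measure h (box a b) x \<partial>lborel)"
proof -
  define \<psi> where "\<psi> = (\<lambda>n. tensor (\<lambda>j. bump n (a $ j) (b $ j)))"
  have \<psi>m [measurable]: "\<psi> n \<in> borel_measurable borel" for n by (simp add: \<psi>_def)
  have lim: "(\<lambda>n. \<psi> n x) \<longlonglongrightarrow> indicat_real (box a b) x" for x
    unfolding \<psi>_def by (rule tendsto_tensor_bump)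
  have bd: "0 \<le> \<psi> n x" "\<psi> n x \<le> indicat_real (box a b) x" for n x
    unfolding \<psi>_def by (rule tensor_bump_bounds)+
  let ?K = "cbox a (b + h *\<^sub>R e)"
  have bdK: "\<psi> n (x - t *\<^sub>R e) \<le> indicat_real ?K x" if "0 \<le> t" "t \<le> h" for n x t
    by (rule order_trans[OF bd(2)]) (use swept_box[OF that, of x a b] in \<open>auto simp: indicator_def\<close>)
  have bd1: "\<psi> n x \<le> 1" for n x
    by (rule order_trans[OF bd(2)]) (simp add: indicator_def)
  define \<Phi> where "\<Phi> = (\<lambda>n x. \<integral>t. indicator {0..h} t * \<psi> n (x - t *\<^sub>R e) \<partial>lborel)"
  have ih: "integrable lborel (indicat_real {0..h})"
    by (rule integrable_real_indicator) (auto simp: emeasure_lborel_Icc_eq)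
  have i\<Phi>: "integrable lborel (\<lambda>t. indicator {0..h} t * \<psi> n (x - t *\<^sub>R e))" for n x
    by (rule Bochner_Integration.integrable_bound[OF ih]) (auto simp: indicator_def bd bd1)
  have "(\<lambda>n. \<integral>x. f x * (\<psi> n x - \<psi> n (x - h *\<^sub>R e)) \<partial>lborel) \<longlonglongrightarrow>
      (\<integral>x. f x * (indicat_real (box a b) x - indicat_real (box a b) (x - h *\<^sub>R e)) \<partial>lborel)"
  proof (rule integral_dominated_convergence[where w = "\<lambda>x. \<bar>indicator ?K x * f x\<bar>"])
    show "AE x in lborel. norm (f x * (\<psi> n x - \<psi> n (x - h *\<^sub>R e))) \<le> \<bar>indicator ?K x * f x\<bar>" for n
    proof (rule AE_I2)
      fix x
      have "\<bar>\<psi> n x - \<psi> n (x - h *\<^sub>R e)\<bar> \<le> indicator ?K x"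
        using bdK[of 0 n x] bdK[of h n x] bd(1)[of n x] bd(1)[of n "x - h *\<^sub>R e"] h by simp
      then have "\<bar>\<psi> n x - \<psi> n (x - h *\<^sub>R e)\<bar> * \<bar>f x\<bar> \<le> indicator ?K x * \<bar>f x\<bar>"
        by (rule mult_right_mono) simp
      then show "norm (f x * (\<psi> n x - \<psi> n (x - h *\<^sub>R e))) \<le> \<bar>indicator ?K x * f x\<bar>"
        by (simp add: abs_mult mult.commute)
    qed
    show "integrable lborel (\<lambda>x. \<bar>indicator ?K x * f x\<bar>)" using f_int[of a "b + h *\<^sub>R e"] by (rule integrable_abs)
    show "AE x in lborel. (\<lambda>n. f x * (\<psi> n x - \<psi> n (x - h *\<^sub>R e))) \<longlonglongrightarrow>
        f x * (indicat_real (box a b) x - indicat_real (box a b) (x - h *\<^sub>R e))"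
      by (intro AE_I2 tendsto_intros lim)
  qed measurable
  moreover have "(\<lambda>n. - (\<integral>x. g x * \<Phi> n x \<partial>lborel)) \<longlonglongrightarrow> - (\<integral>x. g x * path_measure h (box a b) x \<partial>lborel)"
  proof (intro tendsto_minus integral_dominated_convergence[where w = "\<lambda>x. h * \<bar>indicator ?K x * g x\<bar>"])
    show "AE x in lborel. norm (g x * \<Phi> n x) \<le> h * \<bar>indicator ?K x * g x\<bar>" for n
    proof (rule AE_I2)
      fix x
      have "\<Phi> n x \<ge> 0"
        unfolding \<Phi>_def by (intro integral_nonneg_AE AE_I2) (auto simp: bd)
      moreover have "\<Phi> n x \<le> (\<integral>t. indicator {0..h} t * indicator ?K x \<partial>lborel)"
        unfolding \<Phi>_def
        by (intro integral_mono i\<Phi> Bochner_Integration.integrable_mult_left ih)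
          (auto simp: bdK indicator_def[of "{0..h}"])
      moreover have "(\<integral>t. indicator {0..h} t * indicat_real ?K x \<partial>lborel) = measure lborel {0..h} * indicator ?K x"
        by (simp only: Bochner_Integration.integral_mult_left_zero Bochner_Integration.integral_indicator space_lborel space_borel Int_UNIV_right)
      moreover have "measure lborel {0..h} = h"
        using h by simp
      ultimately have "\<bar>\<Phi> n x\<bar> * \<bar>g x\<bar> \<le> h * indicator ?K x * \<bar>g x\<bar>"
        by (intro mult_right_mono) auto
      then show "norm (g x * \<Phi> n x) \<le> h * \<bar>indicator ?K x * g x\<bar>"
        by (simp add: abs_mult mult_ac)
    qed
    show "integrable lborel (\<lambda>x. h * \<bar>indicator ?K x * g x\<bar>)"
      using g_int[of a "b + h *\<^sub>R e"] by (intro integrable_mult_right integrable_abs)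
    have "(\<lambda>n. \<Phi> n x) \<longlonglongrightarrow> path_measure h (box a b) x" for x
      unfolding \<Phi>_def path_measure_def
    proof (rule integral_dominated_convergence[where w = "indicator {0..h}"])
      show "AE t in lborel. (\<lambda>n. indicator {0..h} t * \<psi> n (x - t *\<^sub>R e)) \<longlonglongrightarrow>
          indicator {0..h} t * indicat_real (box a b) (x - t *\<^sub>R e)"
        by (intro AE_I2 tendsto_intros lim)
    qed (use ih in \<open>auto simp: indicator_def[of "{0..h}"] bd bd1\<close>)
    then show "AE x in lborel. (\<lambda>n. g x * \<Phi> n x) \<longlonglongrightarrow> g x * path_measure h (box a b) x"
      by (intro AE_I2 tendsto_intros)
  qed (unfold \<Phi>_def path_measure_def, measurable)
  moreover have "(\<integral>x. f x * (\<psi> n x - \<psi> n (x - h *\<^sub>R e)) \<partial>lborel) = - (\<integral>x. g x * \<Phi> n x \<partial>lborel)" for n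
    unfolding \<Phi>_def \<psi>_def by (rule test_identity[OF h])
  ultimately show ?thesis using LIMSEQ_unique by simp
qed

lemma nn_integral_box_g: "(\<integral>\<^sup>+x. indicator (cbox a b) x * ennreal \<bar>g x\<bar> \<partial>lborel) < \<infinity>"
proof -
  have "(\<integral>\<^sup>+x. indicator (cbox a b) x * ennreal \<bar>g x\<bar> \<partial>lborel) = (\<integral>\<^sup>+x. ennreal (norm (indicator (cbox a b) x * g x)) \<partial>lborel)"
    by (intro nn_integral_cong) (auto simp: indicator_def)
  then show ?thesis using g_int[of a b] by (simp add: integrable_iff_bounded)
qed

text \<open>Absolute integrability for an exchange of integrals in
  \<open>path_measure_adjoint\<close>: for every t in {0..h} the translated box stays in one closed
  box, on which g is integrable.\<close>

lemma integrable_swept: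
  "integrable (lborel \<Otimes>\<^sub>M lborel) (\<lambda>(x, t). indicator {0..h} t * (indicator (box a b) x * g (x + t *\<^sub>R e)))"
proof (rule integrableI_bounded)
  let ?F = "\<lambda>(x, t). indicator {0..h} t * (indicator (box a b) x * g (x + t *\<^sub>R e))"
  show "?F \<in> borel_measurable (lborel \<Otimes>\<^sub>M lborel)" by measurable
  let ?I = "\<integral>\<^sup>+x. indicator (cbox a (b + h *\<^sub>R e)) x * ennreal \<bar>g x\<bar> \<partial>lborel"
  have "(\<integral>\<^sup>+z. ennreal (norm (?F z)) \<partial>(lborel \<Otimes>\<^sub>M lborel)) = (\<integral>\<^sup>+t. \<integral>\<^sup>+x. ennreal (norm (?F (x, t))) \<partial>lborel \<partial>lborel)"
    by (rule lborel_pair.nn_integral_snd[symmetric]) measurable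
  also have "\<dots> \<le> (\<integral>\<^sup>+t. ?I * indicator {0..h} t \<partial>lborel)"
  proof (rule nn_integral_mono)
    fix t :: real
    have "(\<integral>\<^sup>+x. ennreal (norm (?F (x, t))) \<partial>lborel) \<le>
        (\<integral>\<^sup>+x. (\<lambda>y. indicator {0..h} t * (indicator (cbox a (b + h *\<^sub>R e)) y * ennreal \<bar>g y\<bar>)) (x + t *\<^sub>R e) \<partial>lborel)"
    proof (rule nn_integral_mono)
      fix x
      show "ennreal (norm (?F (x, t))) \<le> (\<lambda>y. indicator {0..h} t * (indicator (cbox a (b + h *\<^sub>R e)) y * ennreal \<bar>g y\<bar>)) (x + t *\<^sub>R e)"
        using swept_box[of t h "x + t *\<^sub>R e" a b] by (auto simp: indicator_def)
    qed
    also have "\<dots> = (\<integral>\<^sup>+x. indicator {0..h} t * (indicator (cbox a (b + h *\<^sub>R e)) x * ennreal \<bar>g x\<bar>) \<partial>lborel)"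
      by (rule lborel_nn_integral_translate) measurable
    also have "\<dots> = ?I * indicator {0..h} t"
      by (subst nn_integral_cmult) (auto simp: mult.commute)
    finally show "(\<integral>\<^sup>+x. ennreal (norm (?F (x, t))) \<partial>lborel) \<le> ?I * indicator {0..h} t" .
  qed
  also have "\<dots> = ?I * emeasure lborel {0..h}"
    by (rule nn_integral_cmult_indicator) simp
  also have "\<dots> < \<infinity>"
    using nn_integral_box_g[of a "b + h *\<^sub>R e"] by (simp add: ennreal_mult_less_top emeasure_lborel_Icc_eq)
  finally show "(\<integral>\<^sup>+z. ennreal (norm (?F z)) \<partial>(lborel \<Otimes>\<^sub>M lborel)) < \<infinity>" .
qed

lemma integrable_swept_back:
  assumes h: "0 \<le> h"
  shows "integrable (lborel \<Otimes>\<^sub>M lborel) (\<lambda>(x, t). g x * (indicator {0..h} t * indicator (box a b) (x - t *\<^sub>R e)))"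
proof (rule integrableI_bounded)
  let ?F = "\<lambda>(x, t). g x * (indicator {0..h} t * indicator (box a b) (x - t *\<^sub>R e))"
  show "?F \<in> borel_measurable (lborel \<Otimes>\<^sub>M lborel)" by measurable
  let ?g = "\<lambda>x. indicator (cbox a (b + h *\<^sub>R e)) x * ennreal \<bar>g x\<bar>"
  have "(\<integral>\<^sup>+z. ennreal (norm (?F z)) \<partial>(lborel \<Otimes>\<^sub>M lborel)) = (\<integral>\<^sup>+x. \<integral>\<^sup>+t. ennreal (norm (?F (x, t))) \<partial>lborel \<partial>lborel)"
    by (rule lborel.nn_integral_fst[symmetric]) measurable
  also have "\<dots> \<le> (\<integral>\<^sup>+x. ?g x * ennreal h \<partial>lborel)"
  proof (rule nn_integral_mono)
    fix x :: "real ^ 'n"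
    have "(\<integral>\<^sup>+t. ennreal (norm (?F (x, t))) \<partial>lborel) \<le> (\<integral>\<^sup>+t. ?g x * indicator {0..h} t \<partial>lborel)"
    proof (rule nn_integral_mono)
      fix t
      show "ennreal (norm (?F (x, t))) \<le> ?g x * indicator {0..h} t"
        using swept_box[of t h x a b] by (auto simp: indicator_def)
    qed
    also have "\<dots> = ?g x * ennreal h"
      using h by (subst nn_integral_cmult_indicator) auto
    finally show "(\<integral>\<^sup>+t. ennreal (norm (?F (x, t))) \<partial>lborel) \<le> ?g x * ennreal h" .
  qed
  also have "\<dots> = (\<integral>\<^sup>+x. ?g x \<partial>lborel) * ennreal h"
    by (rule nn_integral_multc) measurable
  also have "\<dots> < \<infinity>"
    using nn_integral_box_g[of a "b + h *\<^sub>R e"] by (simp add: ennreal_mult_less_top)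
  finally show "(\<integral>\<^sup>+z. ennreal (norm (?F z)) \<partial>(lborel \<Otimes>\<^sub>M lborel)) < \<infinity>" .
qed

text \<open>A Bochner integral, hence 0 by convention at points where g is not integrable along the
  segment.\<close>

definition line_integral :: "real \<Rightarrow> real ^ 'n \<Rightarrow> real" where
  "line_integral h x = (\<integral>t. indicator {0..h} t * g (x + t *\<^sub>R e) \<partial>lborel)"

lemma line_integral_measurable [measurable]: "line_integral h \<in> borel_measurable borel"
  unfolding line_integral_def by measurable

lemma indicator_line_integral:
  "indicator A x * line_integral h x = (\<integral>t. indicator {0..h} t * (indicator A x * g (x + t *\<^sub>R e)) \<partial>lborel)"
  unfolding line_integral_def Bochner_Integration.integral_mult_right_zero[symmetric]
  by (simp only: ac_simps)

lemma integrable_line_integral: "integrable lborel (\<lambda>x. indicator (box a b) x * line_integral h x)"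
proof -
  have "integrable lborel (\<lambda>x. \<integral>t. indicator {0..h} t * (indicator (box a b) x * g (x + t *\<^sub>R e)) \<partial>lborel)"
    using lborel_pair.integrable_fst[OF integrable_swept[of h a b]] by simp
  also have "(\<lambda>x. \<integral>t. indicator {0..h} t * (indicator (box a b) x * g (x + t *\<^sub>R e)) \<partial>lborel) =
      (\<lambda>x. indicator (box a b) x * line_integral h x)"
    by (simp only: indicator_line_integral)
  finally show ?thesis .
qed

text \<open>Exchange the integrals, substitute x + t e for x, and exchange back. The shift moves
  from the box to g.\<close>

lemma path_measure_adjoint:
  assumes h: "0 \<le> h"
  shows "(\<integral>x. g x * path_measure h (box a b) x \<partial>lborel) = (\<integral>x. indicator (box a b) x * line_integral h x \<partial>lborel)"
proof -
  have "(\<integral>x. g x * path_measure h (box a b) x \<partial>lborel) =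
      (\<integral>x. (\<integral>t. g x * (indicator {0..h} t * indicator (box a b) (x - t *\<^sub>R e)) \<partial>lborel) \<partial>lborel)"
    unfolding path_measure_def by simp
  also have "\<dots> = (\<integral>t. (\<integral>x. g x * (indicator {0..h} t * indicator (box a b) (x - t *\<^sub>R e)) \<partial>lborel) \<partial>lborel)"
    by (rule lborel_pair.Fubini_integral[symmetric, OF integrable_swept_back[OF h]])
  also have "\<dots> = (\<integral>t. (\<integral>x. indicator {0..h} t * (indicator (box a b) x * g (x + t *\<^sub>R e)) \<partial>lborel) \<partial>lborel)"
  proof (rule Bochner_Integration.integral_cong)
    fix t :: real
    show "(\<integral>x. g x * (indicator {0..h} t * indicator (box a b) (x - t *\<^sub>R e)) \<partial>lborel) =
        (\<integral>x. indicator {0..h} t * (indicator (box a b) x * g (x + t *\<^sub>R e)) \<partial>lborel)"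
      using lborel_integral_translate[of "\<lambda>x. g x * (indicator {0..h} t * indicator (box a b) (x - t *\<^sub>R e))" "t *\<^sub>R e"]
      by (simp add: mult_ac)
  qed simp
  also have "\<dots> = (\<integral>x. (\<integral>t. indicator {0..h} t * (indicator (box a b) x * g (x + t *\<^sub>R e)) \<partial>lborel) \<partial>lborel)"
    by (rule lborel_pair.Fubini_integral[OF integrable_swept])
  also have "\<dots> = (\<integral>x. indicator (box a b) x * line_integral h x \<partial>lborel)"
    by (simp only: indicator_line_integral)
  finally show ?thesis .
qed

lemma integrable_box_f: "integrable lborel (\<lambda>x. indicator (box a b) x * f x)"
proof (rule Bochner_Integration.integrable_bound[OF f_int[of a b]])
  show "AE x in lborel. norm (indicat_real (box a b) x * f x) \<le> norm (indicat_real (cbox a b) x * f x)"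
    using box_subset_cbox[of a b] by (auto simp: indicator_def)
qed measurable

lemma integrable_box_f_translate: "integrable lborel (\<lambda>x. indicator (box a b) x * f (x + v))"
proof -
  have "integrable lborel (\<lambda>x. indicator (box (a + v) (b + v)) (x + v) * f (x + v))"
    by (rule lborel_integrable_translate[OF integrable_box_f])
  also have "(\<lambda>x. indicat_real (box (a + v) (b + v)) (x + v)) = indicator (box a b)"
    by (auto simp: indicator_def mem_box_cart fun_eq_iff)
  finally show ?thesis by (simp add: fun_eq_iff)
qed

text \<open>By duality, \<open>box_identity\<close> says that the two sides have the same integral
  over every box, which forces equality almost everywhere.\<close>

lemma AE_translate:
  assumes h: "0 \<le> h"
  shows "AE x in lborel. x \<in> box a b \<longrightarrow> f (x + h *\<^sub>R e) - f x = line_integral h x"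
proof -
  \<comment> \<open>The cutoff makes v integrable. A further test box then only replaces the box by
    an intersection, again a box.\<close>
  define v where "v = (\<lambda>x. indicator (box a b) x * (f (x + h *\<^sub>R e) - f x - line_integral h x))"
  have int: "integrable lborel (\<lambda>x. indicator (box c d) x * f (x + h *\<^sub>R e) - indicator (box c d) x * f x
      - indicator (box c d) x * line_integral h x)" for c d
    by (intro Bochner_Integration.integrable_diff integrable_box_f_translate integrable_box_f integrable_line_integral)
  have "AE x in lborel. v x = 0"
  proof (rule AE_eq_0_of_box_integrals)
    show "integrable lborel v"
      using int[of a b] by (simp add: v_def algebra_simps)
    fix c d
    obtain c' d' where box: "box a b \<inter> box c d = box c' d'" by (simp add: box_Int_box)
    have "(\<integral>x. indicator (box c d) x * v x \<partial>lborel) =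
        (\<integral>x. indicator (box c' d') x * f (x + h *\<^sub>R e) - indicator (box c' d') x * f x
          - indicator (box c' d') x * line_integral h x \<partial>lborel)"
      unfolding box[symmetric] v_def by (intro Bochner_Integration.integral_cong) (auto simp: indicator_def)
    also have "\<dots> = (\<integral>x. indicator (box c' d') x * f (x + h *\<^sub>R e) \<partial>lborel) - (\<integral>x. indicator (box c' d') x * f x \<partial>lborel)
        - (\<integral>x. indicator (box c' d') x * line_integral h x \<partial>lborel)"
      by (simp add: Bochner_Integration.integral_diff integrable_box_f_translate integrable_box_f integrable_line_integral)
    also have "(\<integral>x. indicator (box c' d') x * line_integral h x \<partial>lborel) =
        - (\<integral>x. f x * (indicator (box c' d') x - indicator (box c' d') (x - h *\<^sub>R e)) \<partial>lborel)"
      using box_identity[OF h] path_measure_adjoint[OF h] by simp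
    also have "(\<integral>x. f x * (indicator (box c' d') x - indicator (box c' d') (x - h *\<^sub>R e)) \<partial>lborel) =
       (\<integral>x. indicator (box c' d') x * f x - indicator (box c' d') (x - h *\<^sub>R e) * f x \<partial>lborel)"
      by (simp add: algebra_simps)
    also have "\<dots> = (\<integral>x. indicator (box c' d') x * f x \<partial>lborel) - (\<integral>x. indicator (box c' d') (x - h *\<^sub>R e) * f x \<partial>lborel)"
      using lborel_integrable_translate[OF integrable_box_f_translate[of c' d' "h *\<^sub>R e"], of "- h *\<^sub>R e"]
      by (intro Bochner_Integration.integral_diff integrable_box_f) simp
    also have "(\<integral>x. indicator (box c' d') (x - h *\<^sub>R e) * f x \<partial>lborel) = (\<integral>x. indicator (box c' d') x * f (x + h *\<^sub>R e) \<partial>lborel)"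
      using lborel_integral_translate[of "\<lambda>x. indicator (box c' d') (x - h *\<^sub>R e) * f x" "h *\<^sub>R e"] by simp
    finally show "(\<integral>x. indicator (box c d) x * v x \<partial>lborel) = 0" by simp
  qed
  then show ?thesis by eventually_elim (auto simp: v_def)
qed

text \<open>After Fubini, each t in {0..h} contributes the integral of |g| over W + t e, a subset of
  Q. Integrating in t produces the factor h.\<close>

lemma translate_L1_le:
  assumes h: "0 \<le> h" and W: "W \<in> sets borel" "W \<subseteq> box a b" and Q: "Q \<in> sets borel"
    and sweep: "\<And>x t. x \<in> W \<Longrightarrow> 0 \<le> t \<Longrightarrow> t \<le> h \<Longrightarrow> x + t *\<^sub>R e \<in> Q"
  shows "(\<integral>\<^sup>+x. indicator W x * ennreal \<bar>f (x + h *\<^sub>R e) - f x\<bar> \<partial>lborel) \<le>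
    ennreal h * (\<integral>\<^sup>+x. indicator Q x * ennreal \<bar>g x\<bar> \<partial>lborel)"
proof -
  note [measurable] = W(1) Q
  let ?I = "\<integral>\<^sup>+x. indicator Q x * ennreal \<bar>g x\<bar> \<partial>lborel"
  have "(\<integral>\<^sup>+x. indicator W x * ennreal \<bar>f (x + h *\<^sub>R e) - f x\<bar> \<partial>lborel) =
      (\<integral>\<^sup>+x. indicator W x * ennreal \<bar>line_integral h x\<bar> \<partial>lborel)"
    using AE_translate[OF h, of a b] W(2)
    by (intro nn_integral_cong_AE) (auto simp: indicator_def elim!: eventually_mono)
  also have "\<dots> \<le> (\<integral>\<^sup>+x. (\<integral>\<^sup>+t. indicator W x * ennreal \<bar>indicator {0..h} t * g (x + t *\<^sub>R e)\<bar> \<partial>lborel) \<partial>lborel)"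
  proof (rule nn_integral_mono)
    fix x
    have "ennreal \<bar>line_integral h x\<bar> \<le> (\<integral>\<^sup>+t. ennreal \<bar>indicator {0..h} t * g (x + t *\<^sub>R e)\<bar> \<partial>lborel)"
    \<comment> \<open>In the nonintegrable case the left side is the default value 0.\<close>
    proof (cases "integrable lborel (\<lambda>t. indicator {0..h} t * g (x + t *\<^sub>R e))")
      case True
      then show ?thesis
        using integral_norm_bound_ennreal[OF True] by (simp add: line_integral_def)
    qed (simp add: line_integral_def not_integrable_integral_eq)
    then show "indicator W x * ennreal \<bar>line_integral h x\<bar> \<le>
        (\<integral>\<^sup>+t. indicator W x * ennreal \<bar>indicator {0..h} t * g (x + t *\<^sub>R e)\<bar> \<partial>lborel)"
      by (subst nn_integral_cmult) (auto intro: mult_left_mono)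
  qed
  also have "\<dots> = (\<integral>\<^sup>+t. (\<integral>\<^sup>+x. indicator W x * ennreal \<bar>indicator {0..h} t * g (x + t *\<^sub>R e)\<bar> \<partial>lborel) \<partial>lborel)"
    by (rule lborel_pair.Fubini'[symmetric]) measurable
  also have "\<dots> \<le> (\<integral>\<^sup>+t. ?I * indicator {0..h} t \<partial>lborel)"
  proof (rule nn_integral_mono)
    fix t :: real
    have "(\<integral>\<^sup>+x. indicator W x * ennreal \<bar>indicator {0..h} t * g (x + t *\<^sub>R e)\<bar> \<partial>lborel) \<le>
        (\<integral>\<^sup>+x. (\<lambda>y. indicator {0..h} t * (indicator Q y * ennreal \<bar>g y\<bar>)) (x + t *\<^sub>R e) \<partial>lborel)"
      using sweep by (intro nn_integral_mono) (auto simp: indicator_def)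
    also have "\<dots> = (\<integral>\<^sup>+x. indicator {0..h} t * (indicator Q x * ennreal \<bar>g x\<bar>) \<partial>lborel)"
      by (rule lborel_nn_integral_translate) measurable
    also have "\<dots> = ?I * indicator {0..h} t"
      by (subst nn_integral_cmult) (auto simp: mult.commute)
    finally show "(\<integral>\<^sup>+x. indicator W x * ennreal \<bar>indicator {0..h} t * g (x + t *\<^sub>R e)\<bar> \<partial>lborel) \<le> ?I * indicator {0..h} t" .
  qed
  also have "\<dots> = ?I * ennreal h"
    using h by (subst nn_integral_cmult_indicator) auto
  finally show ?thesis by (simp add: mult.commute)
qed

end

section \<open>The Poincare inequality on cubes\<close>

locale half_open_cube =
  fixes a :: "real ^ 'n" and l :: real
  assumes l: "0 < l"
begin

definition cube :: "(real ^ 'n) set" where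
  "cube = {x. \<forall>i. a $ i \<le> x $ i \<and> x $ i < a $ i + l}"

lemma cube_borel [measurable]: "cube \<in> sets borel"
  unfolding cube_def by measurable

text \<open>Translation along the i-th circle of the torus: a point that would leave through the
  upper face re-enters at the opposite one.\<close>

definition shift :: "'n \<Rightarrow> real \<Rightarrow> real ^ 'n \<Rightarrow> real ^ 'n" where
  "shift i s x = (if x $ i + s < a $ i + l then x + s *\<^sub>R axis i 1 else x + (s - l) *\<^sub>R axis i 1)"

lemma shift_measurable [measurable]: "shift i s \<in> borel_measurable borel"
  unfolding shift_def by measurable

lemma nn_integral_shift:
  fixes G :: "real ^ 'n \<Rightarrow> ennreal"
  assumes s: "0 \<le> s" "s < l" and G [measurable]: "G \<in> borel_measurable borel"
  shows "(\<integral>\<^sup>+x. indicator cube x * G (shift i s x) \<partial>lborel) = (\<integral>\<^sup>+x. indicator cube x * G x \<partial>lborel)"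
proof -
  \<comment> \<open>\<open>A\<close> and \<open>B\<close> are the images of the points that do not
    wrap around and of those that do. They partition the cube, and the shift is a translation onto
    each.\<close>
  define A where "A = {y\<in>cube. a $ i + s \<le> y $ i}"
  define B where "B = {y\<in>cube. y $ i < a $ i + s}"
  have [measurable]: "A \<in> sets borel" "B \<in> sets borel"
    unfolding A_def B_def by measurable
  have "indicator cube x * G (shift i s x) =
      (\<lambda>y. indicator A y * G y) (x + s *\<^sub>R axis i 1) + (\<lambda>y. indicator B y * G y) (x + (s - l) *\<^sub>R axis i 1)" for x
  proof -
    have cx: "(\<forall>j. a $ j \<le> (x + t *\<^sub>R axis i 1) $ j \<and> (x + t *\<^sub>R axis i 1) $ j < a $ j + l) \<longleftrightarrow>
        (\<forall>j. j \<noteq> i \<longrightarrow> a $ j \<le> x $ j \<and> x $ j < a $ j + l) \<and> a $ i \<le> x $ i + t \<and> x $ i + t < a $ i + l" for t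
      by (auto simp: axis_def)
    have "x + s *\<^sub>R axis i 1 \<in> A \<longleftrightarrow> x \<in> cube \<and> x $ i + s < a $ i + l"
      using s cx[of s] cx[of 0] by (auto simp: A_def cube_def)
    moreover have "x + (s - l) *\<^sub>R axis i 1 \<in> B \<longleftrightarrow> x \<in> cube \<and> \<not> x $ i + s < a $ i + l"
      using s cx[of "s - l"] cx[of 0] by (auto simp: B_def cube_def)
    ultimately show ?thesis by (auto simp: indicator_def shift_def)
  qed
  then have "(\<integral>\<^sup>+x. indicator cube x * G (shift i s x) \<partial>lborel) =
      (\<integral>\<^sup>+x. (\<lambda>y. indicator A y * G y) (x + s *\<^sub>R axis i 1) + (\<lambda>y. indicator B y * G y) (x + (s - l) *\<^sub>R axis i 1) \<partial>lborel)"
    by simp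
  also have "\<dots> = (\<integral>\<^sup>+x. (\<lambda>y. indicator A y * G y) (x + s *\<^sub>R axis i 1) \<partial>lborel) +
      (\<integral>\<^sup>+x. (\<lambda>y. indicator B y * G y) (x + (s - l) *\<^sub>R axis i 1) \<partial>lborel)"
    by (rule nn_integral_add) measurable
  also have "\<dots> = (\<integral>\<^sup>+x. indicator A x * G x \<partial>lborel) + (\<integral>\<^sup>+x. indicator B x * G x \<partial>lborel)"
    by (intro arg_cong2[where f = "(+)"] lborel_nn_integral_translate) measurable
  also have "\<dots> = (\<integral>\<^sup>+x. indicator A x * G x + indicator B x * G x \<partial>lborel)"
    by (rule nn_integral_add[symmetric]) measurable
  also have "\<dots> = (\<integral>\<^sup>+x. indicator cube x * G x \<partial>lborel)"
    by (intro nn_integral_cong) (auto simp: A_def B_def indicator_def)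
  finally show ?thesis .
qed

text \<open>Points that do not wrap around move forward by s, the others back by l - s. Each move
  stays inside the cube, so \<open>translate_L1_le\<close> applies to both parts and the costs add
  up to l.\<close>

lemma shift_L1_le:
  assumes "weak_partial f g i" and s: "0 \<le> s" "s < l"
  shows "(\<integral>\<^sup>+x. indicator cube x * ennreal \<bar>f (shift i s x) - f x\<bar> \<partial>lborel) \<le>
    ennreal l * (\<integral>\<^sup>+x. indicator cube x * ennreal \<bar>g x\<bar> \<partial>lborel)"
proof -
  interpret weak_partial f g i by fact
  let ?I = "\<integral>\<^sup>+x. indicator cube x * ennreal \<bar>g x\<bar> \<partial>lborel"
  define A where "A = (\<lambda>t. {x\<in>cube. x $ i + t < a $ i + l})"
  define B where "B = {x\<in>cube. a $ i + l \<le> x $ i + s}"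
  have [measurable]: "A t \<in> sets borel" "B \<in> sets borel" for t
    unfolding A_def B_def by measurable
  have move: "(\<integral>\<^sup>+x. indicator (A t) x * ennreal \<bar>f (x + t *\<^sub>R e) - f x\<bar> \<partial>lborel) \<le> ennreal t * ?I" if "0 \<le> t" for t
  \<comment> \<open>The cube contains its lower faces while the enclosing box is open, so the lower
    corner is moved outwards, by the arbitrary amount 1.\<close>
  proof (rule translate_L1_le[OF that, where a = "\<chi> j. a $ j - 1" and b = "\<chi> j. a $ j + l"])
    show "A t \<subseteq> box (\<chi> j. a $ j - 1) (\<chi> j. a $ j + l)"
    proof
      fix x assume "x \<in> A t"
      then have "a $ j \<le> x $ j \<and> x $ j < a $ j + l" for j by (auto simp: A_def cube_def)
      then have "a $ j - 1 < x $ j \<and> x $ j < a $ j + l" for j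
        using less_le_trans[of "a $ j - 1" "a $ j" "x $ j"] by simp
      then show "x \<in> box (\<chi> j. a $ j - 1) (\<chi> j. a $ j + l)" by (simp add: mem_box_cart)
    qed
  next
    fix x u assume x: "x \<in> A t" and u: "0 \<le> u" "u \<le> t"
    show "x + u *\<^sub>R e \<in> cube"
      unfolding cube_def
    proof (intro CollectI allI)
      fix j
      show "a $ j \<le> (x + u *\<^sub>R e) $ j \<and> (x + u *\<^sub>R e) $ j < a $ j + l"
        using x u by (cases "j = i") (auto simp: A_def cube_def axis_def intro: add_increasing2)
    qed
  qed measurable
  have "(\<integral>\<^sup>+x. indicator cube x * ennreal \<bar>f (shift i s x) - f x\<bar> \<partial>lborel) =
      (\<integral>\<^sup>+x. indicator (A s) x * ennreal \<bar>f (x + s *\<^sub>R e) - f x\<bar> + indicator B x * ennreal \<bar>f (x + (s - l) *\<^sub>R e) - f x\<bar> \<partial>lborel)"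
    by (intro nn_integral_cong) (auto simp: A_def B_def shift_def indicator_def)
  also have "\<dots> = (\<integral>\<^sup>+x. indicator (A s) x * ennreal \<bar>f (x + s *\<^sub>R e) - f x\<bar> \<partial>lborel) +
      (\<integral>\<^sup>+x. indicator B x * ennreal \<bar>f (x + (s - l) *\<^sub>R e) - f x\<bar> \<partial>lborel)"
    by (rule nn_integral_add) measurable
  \<comment> \<open>Starting from the re-entry point instead turns the backward move into a forward
    one, as required by \<open>translate_L1_le\<close>.\<close>
  also have "(\<integral>\<^sup>+x. indicator B x * ennreal \<bar>f (x + (s - l) *\<^sub>R e) - f x\<bar> \<partial>lborel) =
      (\<integral>\<^sup>+x. (\<lambda>x. indicator B x * ennreal \<bar>f (x + (s - l) *\<^sub>R e) - f x\<bar>) (x + (l - s) *\<^sub>R e) \<partial>lborel)"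
    by (rule lborel_nn_integral_translate[symmetric]) measurable
  also have "\<dots> = (\<integral>\<^sup>+x. indicator (A (l - s)) x * ennreal \<bar>f (x + (l - s) *\<^sub>R e) - f x\<bar> \<partial>lborel)"
  proof (rule nn_integral_cong)
    fix x
    have "x + (l - s) *\<^sub>R e \<in> B \<longleftrightarrow> x \<in> A (l - s)"
    proof
      assume *: "x + (l - s) *\<^sub>R e \<in> B"
      have "a $ j \<le> x $ j \<and> x $ j < a $ j + l" for j
        using * s by (cases "j = i") (auto simp: B_def cube_def axis_def dest!: spec[of _ j])
      then show "x \<in> A (l - s)"
        using * by (auto simp: A_def B_def cube_def axis_def dest!: spec[of _ i])
    next
      assume *: "x \<in> A (l - s)"
      have "a $ j \<le> (x + (l - s) *\<^sub>R e) $ j \<and> (x + (l - s) *\<^sub>R e) $ j < a $ j + l" for j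
        using * s by (cases "j = i") (auto simp: A_def cube_def axis_def intro: add_increasing2)
      moreover have "a $ i \<le> x $ i" using * by (auto simp: A_def cube_def)
      ultimately show "x + (l - s) *\<^sub>R e \<in> B"
        by (auto simp: B_def cube_def axis_def)
    qed
    moreover have "x + (l - s) *\<^sub>R e + (s - l) *\<^sub>R e = x"
      by (simp add: algebra_simps)
    ultimately show "(\<lambda>x. indicator B x * ennreal \<bar>f (x + (s - l) *\<^sub>R e) - f x\<bar>) (x + (l - s) *\<^sub>R e) =
        indicator (A (l - s)) x * ennreal \<bar>f (x + (l - s) *\<^sub>R e) - f x\<bar>"
      by (simp add: indicator_def add.assoc abs_minus_commute)
  qed
  also have "(\<integral>\<^sup>+x. indicator (A s) x * ennreal \<bar>f (x + s *\<^sub>R e) - f x\<bar> \<partial>lborel) + \<dots> \<le>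
      ennreal s * ?I + ennreal (l - s) * ?I"
    using s by (intro add_mono move) auto
  also have "\<dots> = ennreal l * ?I"
    using s by (simp add: distrib_right[symmetric] ennreal_plus[symmetric] del: ennreal_plus)
  finally show ?thesis .
qed

text \<open>Addition on the torus with neutral element a, carried out only in the coordinates of S.
  Partial sets S are the stages of inductions over coordinates; only S = UNIV gives a commutative
  operation in general.\<close>

definition torus_add :: "'n set \<Rightarrow> real ^ 'n \<Rightarrow> real ^ 'n \<Rightarrow> real ^ 'n" where
  "torus_add S y x = (\<chi> j. if j \<in> S then
     (if x $ j + y $ j - a $ j < a $ j + l then x $ j + y $ j - a $ j else x $ j + y $ j - a $ j - l) else x $ j)"

lemma torus_add_commute: "torus_add UNIV x y = torus_add UNIV y x"
  unfolding torus_add_def by (simp only: add.commute UNIV_I if_True)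

lemma torus_add_empty: "torus_add {} y x = x"
  by (simp add: torus_add_def vec_eq_iff)

lemma torus_add_insert:
  assumes "i \<notin> S"
  shows "torus_add (insert i S) y x = shift i (y $ i - a $ i) (torus_add S y x)"
  using assms by (auto simp: torus_add_def shift_def axis_def vec_eq_iff)

lemma torus_add_measurable_pair [measurable]:
  "(\<lambda>(y, x). torus_add S y x) \<in> borel_measurable (borel \<Otimes>\<^sub>M borel)"
proof -
  have "(\<lambda>z. torus_add S (fst z) (snd z)) \<in> borel_measurable (borel \<Otimes>\<^sub>M borel)"
    unfolding borel_measurable_euclidean_space[of "\<lambda>z. torus_add S (fst z) (snd z)"]
  proof
    fix b :: "real ^ 'n" assume "b \<in> Basis"
    then obtain j where b: "b = axis j 1" by (auto simp: Basis_vec_def)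
    have [measurable]: "(\<lambda>x :: real ^ 'n. x $ j) \<in> borel_measurable borel"
      by (intro borel_measurable_continuous_onI continuous_intros)
    show "(\<lambda>z. torus_add S (fst z) (snd z) \<bullet> b) \<in> borel_measurable (borel \<Otimes>\<^sub>M borel)"
      unfolding b inner_axis torus_add_def vec_lambda_beta by (cases "j \<in> S"; simp only: if_True if_False; measurable)
  qed
  then show ?thesis by (simp add: case_prod_beta')
qed

lemma torus_add_measurable [measurable]: "torus_add S y \<in> borel_measurable borel"
proof -
  have "(\<lambda>x. (\<lambda>(y, x). torus_add S y x) (y, x)) \<in> borel_measurable borel"
    by (rule measurable_compose[OF _ torus_add_measurable_pair]) measurable
  then show ?thesis by simp
qed

text \<open>Each inserted coordinate adds one outer \<open>shift\<close>, which is absorbed into the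
  integrand. Hence the induction is over arbitrary G.\<close>

lemma nn_integral_torus_add:
  fixes G :: "real ^ 'n \<Rightarrow> ennreal"
  assumes y: "y \<in> cube" and G: "G \<in> borel_measurable borel"
  shows "(\<integral>\<^sup>+x. indicator cube x * G (torus_add S y x) \<partial>lborel) = (\<integral>\<^sup>+x. indicator cube x * G x \<partial>lborel)"
  using finite[of S] G
proof (induction S arbitrary: G rule: finite_induct)
  case (insert i S)
  note [measurable] = insert.prems
  have s: "0 \<le> y $ i - a $ i" "y $ i - a $ i < l" using y by (auto simp: cube_def algebra_simps)
  have "(\<integral>\<^sup>+x. indicator cube x * G (torus_add (insert i S) y x) \<partial>lborel) =
      (\<integral>\<^sup>+x. indicator cube x * (\<lambda>z. G (shift i (y $ i - a $ i) z)) (torus_add S y x) \<partial>lborel)"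
    using insert.hyps by (simp add: torus_add_insert)
  also have "\<dots> = (\<integral>\<^sup>+x. indicator cube x * G (shift i (y $ i - a $ i) x) \<partial>lborel)"
    by (rule insert.IH) measurable
  also have "\<dots> = (\<integral>\<^sup>+x. indicator cube x * G x \<partial>lborel)"
    by (rule nn_integral_shift[OF s]) measurable
  finally show ?case .
qed (simp add: torus_add_empty)

text \<open>Telescoping over the coordinates: each increment is a one-dimensional shift taken at an
  already translated point, and invariance of the integral moves that point back to x.\<close>

lemma torus_add_L1_le:
  assumes g: "\<And>i. weak_partial f (g i) i" and y: "y \<in> cube"
  shows "(\<integral>\<^sup>+x. indicator cube x * ennreal \<bar>f (torus_add S y x) - f x\<bar> \<partial>lborel) \<le>
    (\<Sum>i\<in>S. ennreal l * (\<integral>\<^sup>+x. indicator cube x * ennreal \<bar>g i x\<bar> \<partial>lborel))"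
  using finite[of S]
proof (induction S rule: finite_induct)
  case (insert i S)
  have f [measurable]: "f \<in> borel_measurable borel" using g[of i] by (simp add: weak_partial_def)
  have s: "0 \<le> y $ i - a $ i" "y $ i - a $ i < l" using y by (auto simp: cube_def algebra_simps)
  let ?h = "\<lambda>z. ennreal \<bar>f (shift i (y $ i - a $ i) z) - f z\<bar>"
  have "(\<integral>\<^sup>+x. indicator cube x * ennreal \<bar>f (torus_add (insert i S) y x) - f x\<bar> \<partial>lborel) \<le>
      (\<integral>\<^sup>+x. indicator cube x * ?h (torus_add S y x) + indicator cube x * ennreal \<bar>f (torus_add S y x) - f x\<bar> \<partial>lborel)"
    using insert.hyps
    by (intro nn_integral_mono)
      (auto simp: torus_add_insert indicator_def ennreal_plus[symmetric] simp del: ennreal_plus intro!: ennreal_leI)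
  also have "\<dots> = (\<integral>\<^sup>+x. indicator cube x * ?h (torus_add S y x) \<partial>lborel) +
      (\<integral>\<^sup>+x. indicator cube x * ennreal \<bar>f (torus_add S y x) - f x\<bar> \<partial>lborel)"
    by (rule nn_integral_add) measurable
  also have "(\<integral>\<^sup>+x. indicator cube x * ?h (torus_add S y x) \<partial>lborel) = (\<integral>\<^sup>+x. indicator cube x * ?h x \<partial>lborel)"
    by (rule nn_integral_torus_add[OF y]) measurable
  also have "\<dots> + (\<integral>\<^sup>+x. indicator cube x * ennreal \<bar>f (torus_add S y x) - f x\<bar> \<partial>lborel) \<le>
      ennreal l * (\<integral>\<^sup>+x. indicator cube x * ennreal \<bar>g i x\<bar> \<partial>lborel) +
      (\<Sum>i\<in>S. ennreal l * (\<integral>\<^sup>+x. indicator cube x * ennreal \<bar>g i x\<bar> \<partial>lborel))"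
    by (intro add_mono shift_L1_le[OF g s] insert.IH)
  finally show ?case using insert.hyps by simp
qed (simp add: torus_add_empty)

text \<open>For fixed \<open>x\<close> the points \<open>x \<oplus> y\<close> of the torus sweep out the cube as \<open>y\<close> does, and \<open>x \<oplus> y = y \<oplus> x\<close>
  turns the double integral into an average of \<open>L\<^sup>1\<close> norms of translation differences.\<close>

lemma double_integral_le:
  assumes g: "\<And>i. weak_partial f (g i) i"
  shows "(\<integral>\<^sup>+x. (\<integral>\<^sup>+z. indicator cube x * indicator cube z * ennreal \<bar>f x - f z\<bar> \<partial>lborel) \<partial>lborel) \<le>
    emeasure lborel cube * (\<Sum>i\<in>UNIV. ennreal l * (\<integral>\<^sup>+x. indicator cube x * ennreal \<bar>g i x\<bar> \<partial>lborel))"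
proof -
  have f [measurable]: "f \<in> borel_measurable borel" using g[of undefined] by (simp add: weak_partial_def)
  let ?R = "\<Sum>i\<in>UNIV. ennreal l * (\<integral>\<^sup>+x. indicator cube x * ennreal \<bar>g i x\<bar> \<partial>lborel)"
  have "(\<integral>\<^sup>+x. (\<integral>\<^sup>+z. indicator cube x * indicator cube z * ennreal \<bar>f x - f z\<bar> \<partial>lborel) \<partial>lborel) =
      (\<integral>\<^sup>+x. (\<integral>\<^sup>+y. indicator cube x * indicator cube y * ennreal \<bar>f x - f (torus_add UNIV y x)\<bar> \<partial>lborel) \<partial>lborel)"
  proof (rule nn_integral_cong)
    fix x
    show "(\<integral>\<^sup>+z. indicator cube x * indicator cube z * ennreal \<bar>f x - f z\<bar> \<partial>lborel) =
        (\<integral>\<^sup>+y. indicator cube x * indicator cube y * ennreal \<bar>f x - f (torus_add UNIV y x)\<bar> \<partial>lborel)"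
    proof (cases "x \<in> cube")
      case True
      then show ?thesis
        using nn_integral_torus_add[OF True, of "\<lambda>z. ennreal \<bar>f x - f z\<bar>" UNIV]
        by (simp add: torus_add_commute[of x])
    qed simp
  qed
  also have "\<dots> = (\<integral>\<^sup>+y. (\<integral>\<^sup>+x. indicator cube x * indicator cube y * ennreal \<bar>f x - f (torus_add UNIV y x)\<bar> \<partial>lborel) \<partial>lborel)"
    by (rule lborel_pair.Fubini') measurable
  also have "\<dots> \<le> (\<integral>\<^sup>+y. ?R * indicator cube y \<partial>lborel)"
  proof (rule nn_integral_mono)
    fix y
    show "(\<integral>\<^sup>+x. indicator cube x * indicator cube y * ennreal \<bar>f x - f (torus_add UNIV y x)\<bar> \<partial>lborel) \<le> ?R * indicator cube y"
    proof (cases "y \<in> cube")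
      case True
      then show ?thesis
        using torus_add_L1_le[OF g True, of UNIV] by (simp add: abs_minus_commute)
    qed simp
  qed
  also have "\<dots> = ?R * emeasure lborel cube"
    by (rule nn_integral_cmult_indicator) simp
  finally show ?thesis by (simp add: mult.commute)
qed

end

text \<open>m |f x - f_Q| is at most the integral of |f x - f z| over z in the cube. Integrating in
  x gives the double integral, whose bound contains the factor m that cancels.\<close>

lemma (in half_open_cube) L1_oscillation_le:
  assumes g: "\<And>i. weak_partial f (g i) i" and f: "integrable lborel (\<lambda>x. indicator cube x * f x)"
    and m: "emeasure lborel cube = ennreal m" "0 < m"
  shows "(\<integral>\<^sup>+x. indicator cube x * ennreal \<bar>f x - (1 / m) * (\<integral>x. indicator cube x * f x \<partial>lborel)\<bar> \<partial>lborel) \<le>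
    (\<Sum>i\<in>UNIV. ennreal l * (\<integral>\<^sup>+x. indicator cube x * ennreal \<bar>g i x\<bar> \<partial>lborel))"
proof -
  have [measurable]: "f \<in> borel_measurable borel" using g[of undefined] by (simp add: weak_partial_def)
  let ?A = "(1 / m) * (\<integral>x. indicator cube x * f x \<partial>lborel)"
  have mm: "measure lborel cube = m" using m by (simp add: measure_def)
  have ic: "integrable lborel (indicat_real cube)"
    using m by (intro integrable_real_indicator) auto
  have "ennreal m * (\<integral>\<^sup>+x. indicator cube x * ennreal \<bar>f x - ?A\<bar> \<partial>lborel) =
      (\<integral>\<^sup>+x. ennreal m * (indicator cube x * ennreal \<bar>f x - ?A\<bar>) \<partial>lborel)"
    by (rule nn_integral_cmult[symmetric]) measurable
  also have "\<dots> \<le> (\<integral>\<^sup>+x. (\<integral>\<^sup>+z. indicator cube x * indicator cube z * ennreal \<bar>f x - f z\<bar> \<partial>lborel) \<partial>lborel)"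
  proof (rule nn_integral_mono)
    fix x
    show "ennreal m * (indicator cube x * ennreal \<bar>f x - ?A\<bar>) \<le>
        (\<integral>\<^sup>+z. indicator cube x * indicator cube z * ennreal \<bar>f x - f z\<bar> \<partial>lborel)"
    proof (cases "x \<in> cube")
      case True
      have int: "integrable lborel (\<lambda>z. indicator cube z * f x - indicator cube z * f z)"
        by (intro Bochner_Integration.integrable_diff f Bochner_Integration.integrable_mult_left ic)
      have "(\<integral>z. indicator cube z * f x - indicator cube z * f z \<partial>lborel) =
          (\<integral>z. indicator cube z * f x \<partial>lborel) - (\<integral>z. indicator cube z * f z \<partial>lborel)"
        by (intro Bochner_Integration.integral_diff f Bochner_Integration.integrable_mult_left ic)
      also have "(\<integral>z. indicator cube z * f x \<partial>lborel) = m * f x"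
        by (simp only: Bochner_Integration.integral_mult_left_zero Bochner_Integration.integral_indicator
          space_lborel space_borel Int_UNIV_right mm)
      also have "m * f x - (\<integral>z. indicator cube z * f z \<partial>lborel) = m * (f x - ?A)"
        using m by (simp add: right_diff_distrib)
      finally have "ennreal m * ennreal \<bar>f x - ?A\<bar> =
          ennreal (norm (\<integral>z. indicator cube z * f x - indicator cube z * f z \<partial>lborel))"
        using m by (simp add: abs_mult ennreal_mult')
      also have "\<dots> \<le> (\<integral>\<^sup>+z. ennreal (norm (indicator cube z * f x - indicator cube z * f z)) \<partial>lborel)"
        by (rule integral_norm_bound_ennreal[OF int])
      also have "\<dots> = (\<integral>\<^sup>+z. indicator cube x * indicator cube z * ennreal \<bar>f x - f z\<bar> \<partial>lborel)"
        using True by (intro nn_integral_cong) (auto simp: indicator_def)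
      finally show ?thesis using True by simp
    qed simp
  qed
  also have "\<dots> \<le> ennreal m * (\<Sum>i\<in>UNIV. ennreal l * (\<integral>\<^sup>+x. indicator cube x * ennreal \<bar>g i x\<bar> \<partial>lborel))"
    using double_integral_le[OF g] m by simp
  finally show ?thesis
    using m by (subst (asm) ennreal_mult_le_mult_iff) auto
qed

section \<open>From Lebesgue measurable functions to Borel representatives\<close>

interpretation lebesgue_cubes: cube_measure "lebesgue :: (real ^ 'n) measure"
proof
  fix K :: "(real ^ 'n) set" assume "compact K"
  then show "emeasure lebesgue K < \<infinity>"
    using emeasure_compact_finite[of K] borel_compact[of K] by simp
qed auto

lemma lebesgue_integral_AE_borel:
  fixes u v :: "real ^ 'n \<Rightarrow> real"
  assumes "u \<in> borel_measurable lebesgue" "v \<in> borel_measurable borel" "AE x in lborel. u x = v x"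
  shows "(\<integral>x. u x \<partial>lebesgue) = (\<integral>x. v x \<partial>lborel)"
proof -
  have v: "v \<in> borel_measurable lborel" using assms by simp
  have "(\<integral>x. u x \<partial>lebesgue) = (\<integral>x. v x \<partial>lebesgue)"
    using assms by (intro integral_cong_AE AE_completion) (auto intro: measurable_completion)
  then show ?thesis using integral_completion[OF v] by simp
qed

lemma lebesgue_integrable_AE_borel:
  fixes u v :: "real ^ 'n \<Rightarrow> real"
  assumes "integrable lebesgue u" "v \<in> borel_measurable borel" "AE x in lborel. u x = v x"
  shows "integrable lborel v"
proof -
  have v: "v \<in> borel_measurable lborel" using assms by simp
  have "integrable lebesgue v"
    using assms
    by (subst integrable_cong_AE[of v _ u])
      (auto intro!: AE_completion measurable_completion elim!: eventually_mono)
  then show ?thesis using integrable_completion[OF v] by simp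
qed

lemma locally_integrable_cbox:
  fixes u v :: "real ^ 'n \<Rightarrow> real"
  assumes u: "locally_integrable lebesgue u" and v: "v \<in> borel_measurable borel" "AE x in lborel. u x = v x"
  shows "integrable lborel (\<lambda>x. indicator (cbox a b) x * v x)"
proof (rule lebesgue_integrable_AE_borel)
  show "integrable lebesgue (\<lambda>x. indicator (cbox a b) x * u x)"
    using u compact_cbox[of a b] by (simp add: locally_integrable_def set_integrable_def)
qed (use v in \<open>auto elim!: eventually_mono\<close>)

lemma weak_partial_of_weak_gradient:
  assumes fg: "weak_gradient f g" and f': "f' \<in> borel_measurable borel" "AE x in lborel. f x = f' x"
    and g': "g' \<in> borel_measurable borel" "AE x in lborel. g x $ i = g' x"
  shows "weak_partial f' g' i"
proof
  show "f' \<in> borel_measurable borel" "g' \<in> borel_measurable borel" by fact+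
  have f: "locally_integrable lebesgue f" and g: "locally_integrable lebesgue (\<lambda>x. g x $ i)"
    using fg by (auto simp: weak_gradient_def)
  show "integrable lborel (\<lambda>x. indicator (cbox a b) x * f' x)" for a b
    by (rule locally_integrable_cbox[OF f f'])
  show "integrable lborel (\<lambda>x. indicator (cbox a b) x * g' x)" for a b
    by (rule locally_integrable_cbox[OF g g'])
  fix \<phi> :: "real ^ 'a \<Rightarrow> real" assume \<phi>: "test_function \<phi>"
  have Ck: "Ck k \<phi>" for k using \<phi> by (simp add: test_function_def)
  have "Ck 0 \<phi>" "Ck 0 (partial_deriv i \<phi>)" using Ck[of 0] Ck[of "Suc 0"] by auto
  then have [measurable]: "\<phi> \<in> borel_measurable borel" "partial_deriv i \<phi> \<in> borel_measurable borel"
    by (auto intro: borel_measurable_continuous_onI)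
  then have [measurable]: "\<phi> \<in> borel_measurable lebesgue" "partial_deriv i \<phi> \<in> borel_measurable lebesgue"
    by (auto intro!: measurable_completion)
  note [measurable] = lebesgue_cubes.locally_integrable_measurable[OF f] lebesgue_cubes.locally_integrable_measurable[OF g] f'(1) g'(1)
  have "(\<integral>x. f x * partial_deriv i \<phi> x \<partial>lebesgue) = (\<integral>x. f' x * partial_deriv i \<phi> x \<partial>lborel)"
    using f'(2) by (intro lebesgue_integral_AE_borel) (auto elim!: eventually_mono)
  moreover have "(\<integral>x. g x $ i * \<phi> x \<partial>lebesgue) = (\<integral>x. g' x * \<phi> x \<partial>lborel)"
    using g'(2) by (intro lebesgue_integral_AE_borel) (auto elim!: eventually_mono)
  ultimately show "(\<integral>x. f' x * partial_deriv i \<phi> x \<partial>lborel) = - (\<integral>x. g' x * \<phi> x \<partial>lborel)"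
    using fg \<phi> by (simp add: weak_gradient_def)
qed

section \<open>Oscillation on dyadic cubes and the Sobolev estimate\<close>

text \<open>The Poincare inequality with constant 1, in terms of the sum of the absolute partial
  derivatives. The argument transfers \<open>L1_oscillation_le\<close> from Borel representatives to
  f and g and divides by the measure of Q.\<close>

lemma mean_osc_le_average_gradient:
  fixes f :: "real ^ 'n \<Rightarrow> real"
  assumes fg: "weak_gradient f g" and Q: "Q \<in> dyadic_cubes"
  shows "mean_osc lebesgue f Q \<le> sidelength Q * average lebesgue (\<lambda>x. \<Sum>i\<in>UNIV. \<bar>g x $ i\<bar>) Q"
proof -
  obtain j where j: "Q = dyadic_cube (generation Q) j" using Q by (rule dyadic_cubesE)
  define a where "a = (\<chi> i. real_of_int (j $ i) * 2 powi generation Q)"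
  interpret half_open_cube a "sidelength Q"
    by standard (simp add: sidelength_eq)
  have "cube = dyadic_cube (generation Q) j"
    unfolding cube_def dyadic_cube_def by (simp add: a_def sidelength_eq algebra_simps)
  then have cube: "cube = Q" using j by simp
  define m where "m = sidelength Q powr real CARD('n)"
  have m: "0 < m" using l by (simp add: m_def)
  have em: "emeasure lebesgue Q = ennreal m"
    by (simp add: m_def emeasure_lebesgue_dyadic[OF Q])
  then have em': "emeasure lborel Q = ennreal m" using dyadic_cubes_borel[OF Q] by simp
  have mm: "measure lebesgue Q = m" using em m by (simp add: measure_def)
  have f: "locally_integrable lebesgue f" and g: "locally_integrable lebesgue (\<lambda>x. g x $ i)" for i
    using fg by (auto simp: weak_gradient_def)
  note fm [measurable] = lebesgue_cubes.locally_integrable_measurable[OF f]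
  note gm [measurable] = lebesgue_cubes.locally_integrable_measurable[OF g]
  have Qb [measurable]: "Q \<in> sets borel" "Q \<in> sets lebesgue" using dyadic_cubes_borel[OF Q] by auto
  obtain f' where f' [measurable]: "f' \<in> borel_measurable borel" and ff: "AE x in lborel. f x = f' x"
    using completion_ex_borel_measurable_real[OF fm] by auto
  have "\<exists>g'. g' \<in> borel_measurable borel \<and> (AE x in lborel. g x $ i = g' x)" for i
    using completion_ex_borel_measurable_real[OF gm[of i]] by auto
  then obtain g' where g' [measurable]: "\<And>i. g' i \<in> borel_measurable borel"
    and gg: "\<And>i. AE x in lborel. g x $ i = g' i x"
    by metis
  have wp: "weak_partial f' (g' i) i" for i
    by (rule weak_partial_of_weak_gradient[OF fg f' ff g' gg])
  have intQ: "integrable lborel (\<lambda>x. indicator Q x * v x)"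
    if "locally_integrable lebesgue u" "v \<in> borel_measurable borel" "AE x in lborel. u x = v x" for u v
  proof (rule lebesgue_integrable_AE_borel)
    show "integrable lebesgue (\<lambda>x. indicator Q x * u x)"
      using lebesgue_cubes.locally_integrable_cube[OF that(1) Q] by (simp add: set_integrable_def)
  qed (use that(2,3) in \<open>auto elim!: eventually_mono\<close>)
  define A where "A = average lebesgue f Q"
  have "(\<integral>x. indicat_real Q x * f x \<partial>lebesgue) = (\<integral>x. indicat_real Q x * f' x \<partial>lborel)"
    using ff by (intro lebesgue_integral_AE_borel) (auto elim!: eventually_mono)
  then have A: "A = (1 / m) * (\<integral>x. indicator Q x * f' x \<partial>lborel)"
    by (simp add: A_def average_def mm set_lebesgue_integral_def)
  have osc: "mean_osc lebesgue f Q = (1 / m) * (\<integral>x. indicator Q x * \<bar>f' x - A\<bar> \<partial>lborel)"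
  proof -
    have "(\<integral>x. indicat_real Q x * \<bar>f x - A\<bar> \<partial>lebesgue) = (\<integral>x. indicat_real Q x * \<bar>f' x - A\<bar> \<partial>lborel)"
      using ff by (intro lebesgue_integral_AE_borel) (auto elim!: eventually_mono)
    then show ?thesis by (simp add: mean_osc_def mm set_lebesgue_integral_def A_def)
  qed
  have gi: "integrable lborel (\<lambda>x. indicator Q x * \<bar>g' i x\<bar>)" for i
    using integrable_abs[OF intQ[OF g g' gg, of i]] by (simp add: abs_mult)
  have avg: "average lebesgue (\<lambda>x. \<Sum>i\<in>UNIV. \<bar>g x $ i\<bar>) Q = (1 / m) * (\<Sum>i\<in>UNIV. \<integral>x. indicator Q x * \<bar>g' i x\<bar> \<partial>lborel)"
  proof -
    have "AE x in lborel. \<forall>i. g x $ i = g' i x"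
      using gg by (subst AE_finite_all[of UNIV, simplified]) auto
    then have "(\<integral>x. indicat_real Q x * (\<Sum>i\<in>UNIV. \<bar>g x $ i\<bar>) \<partial>lebesgue) =
        (\<integral>x. indicat_real Q x * (\<Sum>i\<in>UNIV. \<bar>g' i x\<bar>) \<partial>lborel)"
      by (intro lebesgue_integral_AE_borel) (auto elim!: eventually_mono)
    also have "\<dots> = (\<Sum>i\<in>UNIV. \<integral>x. indicator Q x * \<bar>g' i x\<bar> \<partial>lborel)"
      unfolding sum_distrib_left by (rule Bochner_Integration.integral_sum) (rule gi)
    finally show ?thesis by (simp add: average_def mm set_lebesgue_integral_def)
  qed
  have "ennreal (\<integral>x. indicator Q x * \<bar>f' x - A\<bar> \<partial>lborel) \<le> (\<integral>\<^sup>+x. indicator Q x * ennreal \<bar>f' x - A\<bar> \<partial>lborel)"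
  proof (cases "integrable lborel (\<lambda>x. indicator Q x * \<bar>f' x - A\<bar>)")
    case True
    then have "ennreal (\<integral>x. indicator Q x * \<bar>f' x - A\<bar> \<partial>lborel) = (\<integral>\<^sup>+x. ennreal (indicator Q x * \<bar>f' x - A\<bar>) \<partial>lborel)"
      by (intro nn_integral_eq_integral[symmetric]) auto
    also have "\<dots> = (\<integral>\<^sup>+x. indicator Q x * ennreal \<bar>f' x - A\<bar> \<partial>lborel)"
      by (intro nn_integral_cong) (auto simp: indicator_def)
    finally show ?thesis by simp
  qed (simp add: not_integrable_integral_eq)
  also have "\<dots> \<le> (\<Sum>i\<in>UNIV. ennreal (sidelength Q) * (\<integral>\<^sup>+x. indicator Q x * ennreal \<bar>g' i x\<bar> \<partial>lborel))"
    using L1_oscillation_le[OF wp, unfolded cube, OF intQ[OF f f' ff] em' m] by (simp only: A)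
  also have "\<dots> = (\<Sum>i\<in>UNIV. ennreal (sidelength Q * (\<integral>x. indicator Q x * \<bar>g' i x\<bar> \<partial>lborel)))"
  proof (rule sum.cong)
    fix i
    have "(\<integral>\<^sup>+x. indicator Q x * ennreal \<bar>g' i x\<bar> \<partial>lborel) = (\<integral>\<^sup>+x. ennreal (indicator Q x * \<bar>g' i x\<bar>) \<partial>lborel)"
      by (intro nn_integral_cong) (auto simp: indicator_def)
    also have "\<dots> = ennreal (\<integral>x. indicator Q x * \<bar>g' i x\<bar> \<partial>lborel)"
      by (intro nn_integral_eq_integral gi) auto
    finally show "ennreal (sidelength Q) * (\<integral>\<^sup>+x. indicator Q x * ennreal \<bar>g' i x\<bar> \<partial>lborel) =
        ennreal (sidelength Q * (\<integral>x. indicator Q x * \<bar>g' i x\<bar> \<partial>lborel))"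
      using l by (simp add: ennreal_mult')
  qed simp
  also have "\<dots> = ennreal (sidelength Q * (\<Sum>i\<in>UNIV. \<integral>x. indicator Q x * \<bar>g' i x\<bar> \<partial>lborel))"
    using l by (subst sum_ennreal) (auto simp: sum_distrib_left)
  finally have "(\<integral>x. indicator Q x * \<bar>f' x - A\<bar> \<partial>lborel) \<le> sidelength Q * (\<Sum>i\<in>UNIV. \<integral>x. indicator Q x * \<bar>g' i x\<bar> \<partial>lborel)"
    using l by (subst (asm) ennreal_le_iff) (auto intro!: mult_nonneg_nonneg sum_nonneg)
  then have "(1 / m) * (\<integral>x. indicator Q x * \<bar>f' x - A\<bar> \<partial>lborel) \<le>
      (1 / m) * (sidelength Q * (\<Sum>i\<in>UNIV. \<integral>x. indicator Q x * \<bar>g' i x\<bar> \<partial>lborel))"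
    using m by (intro mult_left_mono) auto
  then show ?thesis unfolding osc avg by (simp only: mult.left_commute)
qed

lemma nn_integral_count_space_subset:
  assumes "A \<subseteq> B"
  shows "(\<integral>\<^sup>+x. w x \<partial>count_space A) \<le> (\<integral>\<^sup>+x. w x \<partial>count_space B)"
  using assms by (auto simp: nn_integral_count_space_indicator indicator_def intro!: nn_integral_mono)

text \<open>The choice \<gamma> = p turns the factor \<ell>(Q)^(\<gamma>/p) of the averages of G
  into \<ell>(Q), exactly the factor in the Poincare inequality. So each cube selected by the
  oscillation is selected by the averages of G, with the same weight.\<close>

lemma Op_norm_le_gradient:
  fixes f :: "real ^ 'n \<Rightarrow> real"
  assumes fg: "weak_gradient f g" and p: "1 < p"
  shows "Op_norm p f \<le> ennreal ((geom_const (2 powr (- p / p * (p - 1))) * 2 powr p) powr (1 / p) * real CARD('n)) * Lp_norm p lebesgue g"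
proof -
  define G where "G = (\<lambda>x. \<Sum>i\<in>UNIV. \<bar>g x $ i\<bar>)"
  let ?C = "(geom_const (2 powr (- p / p * (p - 1))) * 2 powr p) powr (1 / p)"
  have g: "locally_integrable lebesgue (\<lambda>x. g x $ i)" for i
    using fg by (auto simp: weak_gradient_def)
  note [measurable] = lebesgue_cubes.locally_integrable_measurable[OF g]
  have "locally_integrable lebesgue G"
    unfolding locally_integrable_def
  proof (intro allI impI)
    fix K :: "(real ^ 'n) set" assume "compact K"
    then have "set_integrable lebesgue K (\<lambda>x. \<bar>g x $ i\<bar>)" for i
      using g[of i] by (auto simp: locally_integrable_def intro: set_integrable_abs)
    then show "set_integrable lebesgue K G"
      unfolding G_def set_integrable_def scaleR_sum_right by (intro Bochner_Integration.integrable_sum)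
  qed
  then have weak: "weak_lp_norm p p lebesgue (avg_seq p p lebesgue G) \<le> ennreal ?C * Lp_norm p lebesgue G"
    using p by (intro lebesgue_cubes.weak_type_strong) auto
  have "\<bar>avg_seq p p lebesgue G Q\<bar> > t" if "Q \<in> dyadic_cubes" "mean_osc lebesgue f Q > t" for Q t
  proof -
    have s: "0 < sidelength Q" by (simp add: sidelength_eq)
    then have "emeasure lebesgue Q > 0"
      using that by (simp add: emeasure_lebesgue_dyadic)
    then have "avg_seq p p lebesgue G Q = sidelength Q * average lebesgue G Q"
      using p s by (simp add: avg_seq_def)
    then show ?thesis
      using mean_osc_le_average_gradient[OF fg that(1)] that(2) by (simp add: G_def)
  qed
  then have "Op_norm p f \<le> weak_lp_norm p p lebesgue (avg_seq p p lebesgue G)"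
    unfolding Op_norm_def weak_lp_norm_def using p
    by (intro ennpowr_mono SUP_mono' mult_left_mono nn_integral_count_space_subset) auto
  also have "\<dots> \<le> ennreal ?C * Lp_norm p lebesgue G" by (rule weak)
  also have "Lp_norm p lebesgue G \<le> ennreal ((real CARD('n) powr p) powr (1 / p)) * Lp_norm p lebesgue g"
    unfolding Lp_norm_def
  proof (rule ennpowr_le_mult)
    have "(\<lambda>x. norm (g x)) \<in> borel_measurable lebesgue"
      unfolding norm_vec_def L2_set_def by measurable
    then have [measurable]: "(\<lambda>x. ennreal (norm (g x) powr p)) \<in> borel_measurable lebesgue"
      by measurable
    have "(\<integral>\<^sup>+x. ennreal (norm (G x) powr p) \<partial>lebesgue) \<le> (\<integral>\<^sup>+x. ennreal (real CARD('n) powr p) * ennreal (norm (g x) powr p) \<partial>lebesgue)"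
    proof (rule nn_integral_mono)
      fix x
      \<comment> \<open>Each of the n components is bounded by the norm, whence the factor n in the
        final constant.\<close>
      have "norm (G x) \<le> real CARD('n) * norm (g x)"
        using sum_bounded_above[of UNIV "\<lambda>i. \<bar>g x $ i\<bar>" "norm (g x)"] component_le_norm_cart[of "g x"]
        by (simp add: G_def sum_nonneg)
      then have "norm (G x) powr p \<le> real CARD('n) powr p * norm (g x) powr p"
        using p by (subst powr_mult[symmetric]) (auto intro!: powr_mono2)
      then show "ennreal (norm (G x) powr p) \<le> ennreal (real CARD('n) powr p) * ennreal (norm (g x) powr p)"
        by (simp add: ennreal_mult'[symmetric] ennreal_leI)
    qed
    also have "\<dots> = ennreal (real CARD('n) powr p) * (\<integral>\<^sup>+x. ennreal (norm (g x) powr p) \<partial>lebesgue)"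
      by (rule nn_integral_cmult) measurable
    finally show "(\<integral>\<^sup>+x. ennreal (norm (G x) powr p) \<partial>lebesgue) \<le> ennreal (real CARD('n) powr p) * (\<integral>\<^sup>+x. ennreal (norm (g x) powr p) \<partial>lebesgue)" .
  qed (use p in auto)
  finally show ?thesis
    using p by (simp add: powr_powr ennreal_mult' mult.assoc mult_left_mono)
qed

section \<open>The estimates with constants uniform in the measure and the function\<close>

lemma radon_measure_cube_measure: "radon_measure \<mu> \<Longrightarrow> cube_measure \<mu>"
  by (simp add: radon_measure_def cube_measure_def)

theorem theorem3p3:
  fixes p \<gamma> :: real
  assumes "1 \<le> p"
  shows
    "((\<gamma> < 0 \<longrightarrow>
        (\<exists>C>0. \<forall>(\<mu> :: (real ^ 'n) measure) f. radon_measure \<mu> \<and> locally_integrable \<mu> f \<longrightarrow>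
           weak_lp_norm p \<gamma> \<mu> (avg_seq p \<gamma> \<mu> f) \<le> ennreal C * Lp_norm p \<mu> f)) \<and>
      (\<forall>d c\<^sub>1 c\<^sub>2. \<gamma> > d \<and> d > 0 \<longrightarrow>
        (\<exists>C>0. \<forall>(\<mu> :: (real ^ 'n) measure) f. radon_measure \<mu> \<and> locally_integrable \<mu> f \<and>
           (\<forall>Q\<in>dyadic_cubes. emeasure \<mu> Q \<le> ennreal c\<^sub>1 * ennreal (sidelength Q powr d) \<and>
              ennreal (sidelength Q powr d) \<le> ennreal c\<^sub>2 * emeasure \<mu> Q) \<longrightarrow>
           weak_lp_norm p \<gamma> \<mu> (avg_seq p \<gamma> \<mu> f) \<le> ennreal C * Lp_norm p \<mu> f)) \<and>
      (1 < p \<and> \<gamma> \<noteq> 0 \<longrightarrow>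
        (\<exists>C>0. \<forall>(\<mu> :: (real ^ 'n) measure) f. radon_measure \<mu> \<and> locally_integrable \<mu> f \<longrightarrow>
           weak_lp_norm p \<gamma> \<mu> (avg_seq p \<gamma> \<mu> f) \<le> ennreal C * Lp_norm p \<mu> f)))
     \<and>
     (\<gamma> \<notin> {0..real CARD('n)} \<longrightarrow>
        (\<exists>C>0. \<forall>f :: real ^ 'n \<Rightarrow> real. locally_integrable lebesgue f \<longrightarrow>
           Op_gamma_norm p \<gamma> f \<le> ennreal C * JN_norm p f))
     \<and>
     (1 < p \<longrightarrow>
        (\<exists>C>0. \<forall>(f :: real ^ 'n \<Rightarrow> real) g. f \<in> homogeneous_sobolev p \<and> weak_gradient f g \<longrightarrow>
           Op_norm p f \<le> ennreal C * Lp_norm p lebesgue g))"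
proof -
  have strong: "\<exists>C>0. \<forall>(\<mu> :: (real ^ 'n) measure) f. radon_measure \<mu> \<and> locally_integrable \<mu> f \<longrightarrow>
      weak_lp_norm p \<gamma> \<mu> (avg_seq p \<gamma> \<mu> f) \<le> ennreal C * Lp_norm p \<mu> f" if p: "1 < p" and \<gamma>: "\<gamma> \<noteq> 0"
  proof (intro exI conjI allI impI)
    show "(geom_const (2 powr (- \<gamma> / p * (p - 1))) * 2 powr p) powr (1 / p) > 0"
      using geom_const_pos[of "2 powr (- \<gamma> / p * (p - 1))"] p \<gamma> by (simp add: powr_eq_one_iff_gen)
    fix \<mu> :: "(real ^ 'n) measure" and f
    assume "radon_measure \<mu> \<and> locally_integrable \<mu> f"
    then show "weak_lp_norm p \<gamma> \<mu> (avg_seq p \<gamma> \<mu> f) \<le>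
        ennreal ((geom_const (2 powr (- \<gamma> / p * (p - 1))) * 2 powr p) powr (1 / p)) * Lp_norm p \<mu> f"
      using cube_measure.weak_type_strong[OF radon_measure_cube_measure _ \<gamma> p] by blast
  qed
  have negative: "\<exists>C>0. \<forall>(\<mu> :: (real ^ 'n) measure) f. radon_measure \<mu> \<and> locally_integrable \<mu> f \<longrightarrow>
      weak_lp_norm p \<gamma> \<mu> (avg_seq p \<gamma> \<mu> f) \<le> ennreal C * Lp_norm p \<mu> f" if \<gamma>: "\<gamma> < 0"
  proof (cases "p = 1")
    case True
    show ?thesis unfolding True
    proof (intro exI conjI allI impI)
      show "geom_const (2 powr (- \<gamma>)) > 0"
        using \<gamma> by (intro geom_const_pos) (auto simp: powr_eq_one_iff_gen)
      fix \<mu> :: "(real ^ 'n) measure" and f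
      assume "radon_measure \<mu> \<and> locally_integrable \<mu> f"
      then show "weak_lp_norm 1 \<gamma> \<mu> (avg_seq 1 \<gamma> \<mu> f) \<le> ennreal (geom_const (2 powr (- \<gamma>))) * Lp_norm 1 \<mu> f"
        using cube_measure.weak_type_negative[OF radon_measure_cube_measure _ \<gamma>] by blast
    qed
  qed (use strong \<gamma> assms in auto)
  have doubling: "\<exists>C>0. \<forall>(\<mu> :: (real ^ 'n) measure) f. radon_measure \<mu> \<and> locally_integrable \<mu> f \<and>
           (\<forall>Q\<in>dyadic_cubes. emeasure \<mu> Q \<le> ennreal c\<^sub>1 * ennreal (sidelength Q powr d) \<and>
              ennreal (sidelength Q powr d) \<le> ennreal c\<^sub>2 * emeasure \<mu> Q) \<longrightarrow>
           weak_lp_norm p \<gamma> \<mu> (avg_seq p \<gamma> \<mu> f) \<le> ennreal C * Lp_norm p \<mu> f"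
    if \<gamma>: "d < \<gamma>" "0 < d" for d c\<^sub>1 c\<^sub>2
  proof (cases "p = 1")
    case True
    \<comment> \<open>The constant has to be fixed before a measure is given, for arbitrary real
      \<open>c\<^sub>1\<close> and \<open>c\<^sub>2\<close>. The value 1 is a placeholder for pairs
      that no measure satisfies.\<close>
    define C where "C = (if 0 < c\<^sub>1 \<and> 0 < c\<^sub>2 then c\<^sub>1 * c\<^sub>2 * geom_const (2 powr (d - \<gamma>)) else 1)"
    show ?thesis unfolding True
    proof (intro exI conjI allI impI)
      show "C > 0"
        using geom_const_pos[of "2 powr (d - \<gamma>)"] \<gamma> by (auto simp: C_def powr_eq_one_iff_gen)
      fix \<mu> :: "(real ^ 'n) measure" and f
      assume *: "radon_measure \<mu> \<and> locally_integrable \<mu> f \<and>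
           (\<forall>Q\<in>dyadic_cubes. emeasure \<mu> Q \<le> ennreal c\<^sub>1 * ennreal (sidelength Q powr d) \<and>
              ennreal (sidelength Q powr d) \<le> ennreal c\<^sub>2 * emeasure \<mu> Q)"
      \<comment> \<open>On the unit cube the comparison reads \<mu>(Q) \<le>
        \<open>c\<^sub>1\<close> and 1 \<le> \<open>c\<^sub>2\<close> \<mu>(Q), which forces both
        constants to be positive.\<close>
      have "dyadic_cube 0 0 \<in> (dyadic_cubes :: (real ^ 'n) set set)"
        by (auto simp: dyadic_cubes_def)
      with * have "emeasure \<mu> (dyadic_cube 0 0) \<le> ennreal c\<^sub>1" "1 \<le> ennreal c\<^sub>2 * emeasure \<mu> (dyadic_cube 0 0)"
        by (metis ennreal_1 mult.right_neutral sidelength_dyadic_cube power_int_0_right powr_one_eq_one)+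
      then have "ennreal c\<^sub>1 \<noteq> 0" "ennreal c\<^sub>2 \<noteq> 0" by auto
      then have "0 < c\<^sub>1" "0 < c\<^sub>2" by (simp_all add: ennreal_eq_0_iff)
      then show "weak_lp_norm 1 \<gamma> \<mu> (avg_seq 1 \<gamma> \<mu> f) \<le> ennreal C * Lp_norm 1 \<mu> f"
        unfolding C_def using * \<gamma>
          cube_measure.weak_type_doubling[OF radon_measure_cube_measure, of \<mu> f d \<gamma> c\<^sub>1 c\<^sub>2] by simp
    qed
  next
    case False
    then have "1 < p" "\<gamma> \<noteq> 0" using \<gamma> assms by auto
    from strong[OF this] show ?thesis by blast
  qed
  have JN: "\<exists>C>0. \<forall>f :: real ^ 'n \<Rightarrow> real. locally_integrable lebesgue f \<longrightarrow>
      Op_gamma_norm p \<gamma> f \<le> ennreal C * JN_norm p f" if "\<gamma> \<notin> {0..real CARD('n)}"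
  proof (intro exI conjI allI impI)
    have \<gamma>: "\<gamma> < 0 \<or> real CARD('n) < \<gamma>" using that by auto
    then show "geom_const (if \<gamma> < 0 then 2 powr (- \<gamma>) else 2 powr (real CARD('n) - \<gamma>)) powr (1 / p) > 0"
      using geom_const_pos[of "if \<gamma> < 0 then 2 powr (- \<gamma>) else 2 powr (real CARD('n) - \<gamma>)"]
      by (auto simp: powr_eq_one_iff_gen split: if_splits)
    show "Op_gamma_norm p \<gamma> f \<le>
        ennreal (geom_const (if \<gamma> < 0 then 2 powr (- \<gamma>) else 2 powr (real CARD('n) - \<gamma>)) powr (1 / p)) * JN_norm p f"
      for f :: "real ^ 'n \<Rightarrow> real"
      by (rule Op_gamma_norm_le_JN_norm[OF assms \<gamma>])
  qed
  have sobolev: "\<exists>C>0. \<forall>(f :: real ^ 'n \<Rightarrow> real) g. f \<in> homogeneous_sobolev p \<and> weak_gradient f g \<longrightarrow>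
      Op_norm p f \<le> ennreal C * Lp_norm p lebesgue g" if p: "1 < p"
  proof (intro exI conjI allI impI)
    show "(geom_const (2 powr (- p / p * (p - 1))) * 2 powr p) powr (1 / p) * real CARD('n) > 0"
      using geom_const_pos[of "2 powr (- p / p * (p - 1))"] p by (simp add: powr_eq_one_iff_gen)
    show "Op_norm p f \<le> ennreal ((geom_const (2 powr (- p / p * (p - 1))) * 2 powr p) powr (1 / p) * real CARD('n)) * Lp_norm p lebesgue g"
      if "f \<in> homogeneous_sobolev p \<and> weak_gradient f g" for f :: "real ^ 'n \<Rightarrow> real" and g
      using that p by (intro Op_norm_le_gradient) auto
  qed
  show ?thesis
    using strong negative doubling JN sobolev by blast
qed

end
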